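(* Let $d\in\{2,3\}$, $B=\{x\in\mathbb R^d:|x|\le R\}$, $s>0$, $Y=L^2(B)$ (complex-valued). Let $\mu$ be a Borel probability measure on $X=L^2(\mathbb S^{d-1}\times\mathbb S^{d-1})$ and $\mathscr G:X\to Y$ Borel measurable. Assume that the pushforward $\mathscr G_\#\mu$ is supported on $H^s(B)$ and that $\|q\|_{H^s(B)}\le C_q$ for all $q\in\operatorname{supp}(\mathscr G_\#\mu)$. For $n\in\mathbb N$ let $r_p=\dim_{\mathbb C}\mathbb P_n(B)$ be the number of retained complex reconstruction modes (so $r_p\asymp n^d$) and $p:=2r_p$. Suppose the reconstructor $\mathcal R_{\mathrm{SH}}:\mathbb R^p\to Y$ and projector $\mathcal P:Y\to\mathbb R^p$ are chosen so that $$\mathcal R_{\mathrm{SH}}\circ\mathcal P=P_{r_p},$$ where $P_{r_p}$ is the complex $L^2(B)$-orthogonal projection onto $V_{r_p}=\operatorname{span}_{\mathbb C}\{\phi_1,\dots,\phi_{r_p}\}=\mathbb P_n(B)$. Then there is a constant $C=C(B,d,s)>0$ such that $$\mathscr E_{\mathcal R}:=\left(\int_Y\|(\mathcal R_{\mathrm{SH}}\circ\mathcal P)(v)-v\|_Y^2\,d(\mathscr G_\#\mu)(v)\right)^{1/2}\le C\,C_q\,p^{-s/d}.$$ In particular, for $\varepsilon>0$, to guarantee $\mathscr E_{\mathcal R}\le\varepsilon$ it suffices to choose the even real reconstruction dimension $p$ such that $p\ge(C\,C_q/\varepsilon)^{d/s}$.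
   Context: $\mathbb P_n(B)$ is the space of (restrictions to $B$ of) complex polynomials of total degree at most $n$ in $d$ variables. $\{\phi_1,\phi_2,\dots\}$ is a real-valued orthonormal polynomial basis of $L^2(B;\mathbb R)$ (spherical-harmonic–Jacobi basis; Fourier–Jacobi if $d=2$), ordered by degree so that the first $r_p=\dim_{\mathbb C}\mathbb P_n(B)$ functions span $\mathbb P_n(B)$ over $\mathbb C$; $P_{r_p}q=\sum_{k=1}^{r_p}\langle q,\phi_k\rangle_{L^2(B)}\phi_k$. *)

theory Defs
  imports "HOL-Probability.Probability" "HOL-Library.Function_Algebras"
begin

section \<open>The space $L^2$\<close>

text \<open>
  Elements of \<open>L2 M\<close> are equivalence classes of square-integrable functions modulo equality
  almost everywhere.  If \<open>M\<close> is a restriction to a set \<open>B\<close>, the values of a representative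
  outside \<open>B\<close> are arbitrary, so a function \<open>U\<close> on the whole space satisfies \<open>U \<in> u\<close> iff its
  restriction to \<open>B\<close> represents \<open>u\<close>.
\<close>

definition L2_fun :: "'a measure \<Rightarrow> ('a \<Rightarrow> complex) set" where
  "L2_fun M = {f \<in> borel_measurable M. integrable M (\<lambda>x. (cmod (f x))\<^sup>2)}"

definition L2_rel :: "'a measure \<Rightarrow> (('a \<Rightarrow> complex) \<times> ('a \<Rightarrow> complex)) set" where
  "L2_rel M = {(f, g). f \<in> L2_fun M \<and> g \<in> L2_fun M \<and> (AE x in M. f x = g x)}"

definition L2 :: "'a measure \<Rightarrow> ('a \<Rightarrow> complex) set set" where
  "L2 M = L2_fun M // L2_rel M"

definition L2_class :: "'a measure \<Rightarrow> ('a \<Rightarrow> complex) \<Rightarrow> ('a \<Rightarrow> complex) set" where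
  "L2_class M f = L2_rel M `` {f}"

definition L2_rep :: "('a \<Rightarrow> complex) set \<Rightarrow> 'a \<Rightarrow> complex" where
  "L2_rep u = (SOME f. f \<in> u)"

definition L2_fnorm :: "'a measure \<Rightarrow> ('a \<Rightarrow> complex) \<Rightarrow> real" where
  "L2_fnorm M f = sqrt (\<integral>x. (cmod (f x))\<^sup>2 \<partial>M)"

definition L2_inner :: "'a measure \<Rightarrow> ('a \<Rightarrow> complex) set \<Rightarrow> ('a \<Rightarrow> complex) set \<Rightarrow> complex" where
  "L2_inner M u v = (\<integral>x. L2_rep u x * cnj (L2_rep v x) \<partial>M)"

text \<open>\<open>L2_dist M u v\<close> is the norm of \<open>u - v\<close>.\<close>

definition L2_dist :: "'a measure \<Rightarrow> ('a \<Rightarrow> complex) set \<Rightarrow> ('a \<Rightarrow> complex) set \<Rightarrow> real" where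
  "L2_dist M u v = L2_fnorm M (\<lambda>x. L2_rep u x - L2_rep v x)"

lemma L2_fun_measurable: "f \<in> L2_fun M \<Longrightarrow> f \<in> borel_measurable M"
  by (simp add: L2_fun_def)

lemma L2_fun_integrable: "f \<in> L2_fun M \<Longrightarrow> integrable M (\<lambda>x. (cmod (f x))\<^sup>2)"
  by (simp add: L2_fun_def)

lemma norm_add_sq_le:
  fixes a b :: complex
  shows "(cmod (a + b))\<^sup>2 \<le> 2 * (cmod a)\<^sup>2 + 2 * (cmod b)\<^sup>2"
proof -
  have "(cmod (a + b))\<^sup>2 \<le> (cmod a + cmod b)\<^sup>2"
    by (intro power_mono norm_triangle_ineq) simp
  also have "\<dots> \<le> 2 * (cmod a)\<^sup>2 + 2 * (cmod b)\<^sup>2"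
    using sum_squares_bound[of "cmod a" "cmod b"] by (simp add: power2_sum)
  finally show ?thesis .
qed

lemma L2_fun_add:
  assumes f: "f \<in> L2_fun M" and g: "g \<in> L2_fun M"
  shows "(\<lambda>x. f x + g x) \<in> L2_fun M"
proof -
  note [measurable] = L2_fun_measurable[OF f] L2_fun_measurable[OF g]
  have "integrable M (\<lambda>x. 2 * (cmod (f x))\<^sup>2 + 2 * (cmod (g x))\<^sup>2)"
    using L2_fun_integrable[OF f] L2_fun_integrable[OF g] by simp
  then have "integrable M (\<lambda>x. (cmod (f x + g x))\<^sup>2)"
    by (rule Bochner_Integration.integrable_bound) (use norm_add_sq_le in auto)
  then show ?thesis by (simp add: L2_fun_def)
qed

lemma L2_fun_minus:
  assumes "g \<in> L2_fun M"
  shows "(\<lambda>x. - g x) \<in> L2_fun M"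
  using assms by (simp add: L2_fun_def)

lemma L2_fun_diff:
  assumes "f \<in> L2_fun M" "g \<in> L2_fun M"
  shows "(\<lambda>x. f x - g x) \<in> L2_fun M"
  using L2_fun_add[OF assms(1) L2_fun_minus[OF assms(2)]] by simp

lemma L2_fnorm_nonneg: "0 \<le> L2_fnorm M f"
  by (simp add: L2_fnorm_def)

lemma L2_fnorm_square: "(L2_fnorm M f)\<^sup>2 = (\<integral>x. (cmod (f x))\<^sup>2 \<partial>M)"
  by (simp add: L2_fnorm_def)

lemma L2_fnorm_eq_0_iff:
  assumes "f \<in> L2_fun M"
  shows "L2_fnorm M f = 0 \<longleftrightarrow> (AE x in M. f x = 0)"
  using integral_nonneg_eq_0_iff_AE[OF L2_fun_integrable[OF assms]]
  by (simp add: L2_fnorm_def)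

lemma L2_fnorm_cong_AE:
  assumes "f \<in> L2_fun M" "g \<in> L2_fun M" "AE x in M. f x = g x"
  shows "L2_fnorm M f = L2_fnorm M g"
proof -
  note [measurable] = L2_fun_measurable[OF assms(1)] L2_fun_measurable[OF assms(2)]
  show ?thesis unfolding L2_fnorm_def
    by (intro arg_cong[of _ _ sqrt] integral_cong_AE) (use assms(3) in auto)
qed

lemma L2_fnorm_triangle:
  assumes f: "f \<in> L2_fun M" and g: "g \<in> L2_fun M"
  shows "L2_fnorm M (\<lambda>x. f x + g x) \<le> L2_fnorm M f + L2_fnorm M g"
proof -
  let ?A = "L2_fnorm M f" and ?B = "L2_fnorm M g"
  have fg: "(\<lambda>x. f x + g x) \<in> L2_fun M" by (rule L2_fun_add[OF f g])
  consider "?A = 0" | "?B = 0" | "?A > 0" "?B > 0"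
    using L2_fnorm_nonneg[of M f] L2_fnorm_nonneg[of M g] by linarith
  then show ?thesis
  proof cases
    case 1
    then have "AE x in M. f x + g x = g x" using L2_fnorm_eq_0_iff[OF f] by auto
    then show ?thesis using L2_fnorm_cong_AE[OF fg g] 1 by simp
  next
    case 2
    then have "AE x in M. f x + g x = f x" using L2_fnorm_eq_0_iff[OF g] by auto
    then show ?thesis using L2_fnorm_cong_AE[OF fg f] 2 by simp
  next
    case 3
    define t where "t = ?B / ?A"
    have t: "t > 0" using 3 by (simp add: t_def)
    have pw: "(cmod (f x + g x))\<^sup>2 \<le> (1 + t) * (cmod (f x))\<^sup>2 + (1 + 1/t) * (cmod (g x))\<^sup>2" for x
    proof -
      let ?a = "cmod (f x)" and ?b = "cmod (g x)"
      have "0 \<le> (t * ?a - ?b)\<^sup>2 / t" using t by simp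
      also have "\<dots> = t * ?a\<^sup>2 - 2 * ?a * ?b + ?b\<^sup>2 / t"
        using t by (simp add: power2_diff field_simps power2_eq_square)
      finally have "2 * ?a * ?b \<le> t * ?a\<^sup>2 + ?b\<^sup>2 / t" by simp
      moreover have "(cmod (f x + g x))\<^sup>2 \<le> (?a + ?b)\<^sup>2"
        by (intro power_mono norm_triangle_ineq) simp
      ultimately show ?thesis by (simp add: power2_sum algebra_simps)
    qed
    have "(L2_fnorm M (\<lambda>x. f x + g x))\<^sup>2 = (\<integral>x. (cmod (f x + g x))\<^sup>2 \<partial>M)"
      by (rule L2_fnorm_square)
    also have "\<dots> \<le> (\<integral>x. (1 + t) * (cmod (f x))\<^sup>2 + (1 + 1/t) * (cmod (g x))\<^sup>2 \<partial>M)"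
      using L2_fun_integrable[OF f] L2_fun_integrable[OF g] L2_fun_integrable[OF fg] pw
      by (intro integral_mono) auto
    also have "\<dots> = (1 + t) * ?A\<^sup>2 + (1 + 1/t) * ?B\<^sup>2"
      using L2_fun_integrable[OF f] L2_fun_integrable[OF g]
      by (simp add: L2_fnorm_square del: distrib_left_numeral)
    also have "\<dots> = (?A + ?B)\<^sup>2"
      using 3 by (simp add: t_def field_simps power2_eq_square)
    finally show ?thesis
      by (rule power2_le_imp_le) (use 3 in simp)
  qed
qed

lemma equiv_L2_rel: "equiv (L2_fun M) (L2_rel M)"
proof (rule equivI)
  show "L2_rel M \<subseteq> L2_fun M \<times> L2_fun M" by (auto simp: L2_rel_def)
  show "refl_on (L2_fun M) (L2_rel M)" by (auto simp: refl_on_def L2_rel_def)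
  show "sym (L2_rel M)" by (auto simp: sym_def L2_rel_def elim!: eventually_mono)
  show "trans (L2_rel M)"
  proof (rule transI)
    fix f g h assume "(f, g) \<in> L2_rel M" "(g, h) \<in> L2_rel M"
    then have fh: "f \<in> L2_fun M" "h \<in> L2_fun M"
      and fg: "AE x in M. f x = g x" and gh: "AE x in M. g x = h x"
      by (auto simp: L2_rel_def)
    from fg gh have "AE x in M. f x = h x" by eventually_elim simp
    with fh show "(f, h) \<in> L2_rel M" by (simp add: L2_rel_def)
  qed
qed

lemma L2_class_in: "f \<in> L2_fun M \<Longrightarrow> L2_class M f \<in> L2 M"
  by (simp add: L2_class_def L2_def quotientI)

lemma L2_rep_in:
  assumes "u \<in> L2 M"
  shows "L2_rep u \<in> u"
  using in_quotient_imp_non_empty[OF equiv_L2_rel] assms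
  unfolding L2_rep_def L2_def by (metis all_not_in_conv someI_ex)

lemma L2_rep_fun:
  assumes "u \<in> L2 M"
  shows "L2_rep u \<in> L2_fun M"
  using in_quotient_imp_subset[OF equiv_L2_rel] L2_rep_in[OF assms] assms
  unfolding L2_def by blast

lemma Metric_space_L2: "Metric_space (L2 M) (L2_dist M)"
proof
  fix u v w
  show "0 \<le> L2_dist M u v" by (simp add: L2_dist_def L2_fnorm_nonneg)
  show "L2_dist M u v = L2_dist M v u"
    by (simp add: L2_dist_def L2_fnorm_def norm_minus_commute)
  assume u: "u \<in> L2 M" and v: "v \<in> L2 M"
  show "L2_dist M u v = 0 \<longleftrightarrow> u = v"
  proof -
    have "L2_dist M u v = 0 \<longleftrightarrow> (AE x in M. L2_rep u x - L2_rep v x = 0)"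
      unfolding L2_dist_def
      by (intro L2_fnorm_eq_0_iff L2_fun_diff L2_rep_fun u v)
    also have "\<dots> \<longleftrightarrow> (L2_rep u, L2_rep v) \<in> L2_rel M"
      using L2_rep_fun[OF u] L2_rep_fun[OF v] by (simp add: L2_rel_def)
    also have "\<dots> \<longleftrightarrow> u = v"
      using quotient_eq_iff[OF equiv_L2_rel _ _ L2_rep_in[OF u] L2_rep_in[OF v]] u v
      by (simp add: L2_def)
    finally show ?thesis .
  qed
  assume w: "w \<in> L2 M"
  show "L2_dist M u w \<le> L2_dist M u v + L2_dist M v w"
    using L2_fnorm_triangle[OF L2_fun_diff[OF L2_rep_fun[OF u] L2_rep_fun[OF v]]
        L2_fun_diff[OF L2_rep_fun[OF v] L2_rep_fun[OF w]]]
    by (simp add: L2_dist_def)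
qed

definition L2_topology :: "'a measure \<Rightarrow> ('a \<Rightarrow> complex) set topology" where
  "L2_topology M = Metric_space.mtopology (L2 M) (L2_dist M)"

definition L2_borel :: "'a measure \<Rightarrow> ('a \<Rightarrow> complex) set measure" where
  "L2_borel M = sigma (L2 M) {U. openin (L2_topology M) U}"

text \<open>The topological support of a Borel measure on \<open>L2 M\<close>.\<close>

definition L2_supp :: "'a measure \<Rightarrow> ('a \<Rightarrow> complex) set measure \<Rightarrow> ('a \<Rightarrow> complex) set set" where
  "L2_supp M \<nu> = {v \<in> L2 M. \<forall>U. openin (L2_topology M) U \<and> v \<in> U \<longrightarrow> emeasure \<nu> U > 0}"


section \<open>The underlying measure spaces\<close>

definition ball_measure :: "real \<Rightarrow> (real ^ 'n) measure" where
  "ball_measure R = restrict_space lborel (cball 0 R)"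

text \<open>
  Surface measure on the unit sphere: the surface area of \<open>A\<close> is \<open>d\<close> times the volume of the cone
  of all \<open>r x\<close> with \<open>x \<in> A\<close> and \<open>0 < r \<le> 1\<close>.
\<close>

definition sphere_measure :: "(real ^ 'n) measure" where
  "sphere_measure = scale_measure (of_nat CARD('n))
     (distr (restrict_space lborel (cball 0 1 - {0})) (restrict_space borel (sphere 0 1))
       (\<lambda>x. x /\<^sub>R norm x))"

definition sphere_prod_measure :: "((real ^ 'n) \<times> (real ^ 'n)) measure" where
  "sphere_prod_measure = sphere_measure \<Otimes>\<^sub>M sphere_measure"


section \<open>Sobolev spaces\<close>

text \<open>
  The $L^2$ Fourier transform in its unitary normalisation: \<open>g\<close> is the limit in $L^2$ of the Fourier
  integrals of \<open>f\<close> truncated to balls (Plancherel).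
\<close>

definition fourier_trunc :: "nat \<Rightarrow> (real ^ 'n \<Rightarrow> complex) \<Rightarrow> real ^ 'n \<Rightarrow> complex" where
  "fourier_trunc k f \<xi> = complex_of_real ((2 * pi) powr (- real CARD('n) / 2)) *
     (LINT x:cball 0 (real k)|lborel. cis (- (x \<bullet> \<xi>)) * f x)"

definition has_fourier :: "(real ^ 'n \<Rightarrow> complex) \<Rightarrow> (real ^ 'n \<Rightarrow> complex) \<Rightarrow> bool" where
  "has_fourier f g \<longleftrightarrow> f \<in> L2_fun lborel \<and> g \<in> L2_fun lborel \<and>
     (\<lambda>k. \<integral>\<^sup>+ \<xi>. ennreal ((cmod (fourier_trunc k f \<xi> - g \<xi>))\<^sup>2) \<partial>lborel) \<longlonglongrightarrow> 0"

definition Hs_space :: "real \<Rightarrow> (real ^ 'n \<Rightarrow> complex) set" where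
  "Hs_space s = {f. \<exists>g. has_fourier f g \<and>
     integrable lborel (\<lambda>\<xi>. (1 + (norm \<xi>)\<^sup>2) powr s * (cmod (g \<xi>))\<^sup>2)}"

definition Hs_space_norm :: "real \<Rightarrow> (real ^ 'n \<Rightarrow> complex) \<Rightarrow> real" where
  "Hs_space_norm s f = (let g = (SOME g. has_fourier f g) in
     sqrt (\<integral>\<xi>. (1 + (norm \<xi>)\<^sup>2) powr s * (cmod (g \<xi>))\<^sup>2 \<partial>lborel))"

text \<open>
  The Sobolev space of the ball consists of the restrictions of functions in the Sobolev space of
  the whole space and carries the quotient norm.
\<close>

definition Hs_ball :: "real \<Rightarrow> real \<Rightarrow> (real ^ 'n \<Rightarrow> complex) set set" where
  "Hs_ball R s = {u \<in> L2 (ball_measure R). u \<inter> Hs_space s \<noteq> {}}"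

definition Hs_ball_norm :: "real \<Rightarrow> real \<Rightarrow> (real ^ 'n \<Rightarrow> complex) set \<Rightarrow> real" where
  "Hs_ball_norm R s u = Inf (Hs_space_norm s ` (u \<inter> Hs_space s))"


section \<open>Polynomials on the ball and the projection\<close>

definition fscale :: "complex \<Rightarrow> ('a \<Rightarrow> complex) \<Rightarrow> 'a \<Rightarrow> complex" where
  "fscale c f = (\<lambda>x. c * f x)"

interpretation cfun: vector_space "fscale :: complex \<Rightarrow> ('a \<Rightarrow> complex) \<Rightarrow> 'a \<Rightarrow> complex"
  by unfold_locales (auto simp: fscale_def fun_eq_iff algebra_simps)

text \<open>
  Restriction to \<open>B\<close>, encoded by extension by zero so that functions on \<open>B\<close> form a linear
  subspace of the functions on the whole space.
\<close>

definition restrict0 :: "'a set \<Rightarrow> ('a \<Rightarrow> complex) \<Rightarrow> 'a \<Rightarrow> complex" where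
  "restrict0 B f = (\<lambda>x. if x \<in> B then f x else 0)"

definition poly_funs :: "nat \<Rightarrow> (real ^ 'n \<Rightarrow> complex) set" where
  "poly_funs n = {f. \<exists>c :: ('n \<Rightarrow> nat) \<Rightarrow> complex.
     f = (\<lambda>x. \<Sum>\<alpha> | (\<Sum>i\<in>UNIV. \<alpha> i) \<le> n. c \<alpha> * complex_of_real (\<Prod>i\<in>UNIV. (x $ i) ^ \<alpha> i))}"

definition poly_ball :: "real \<Rightarrow> nat \<Rightarrow> (real ^ 'n \<Rightarrow> complex) set" where
  "poly_ball R n = restrict0 (cball 0 R) ` poly_funs n"

definition poly_dim :: "'n::finite itself \<Rightarrow> real \<Rightarrow> nat \<Rightarrow> nat" where
  "poly_dim _ R n = cfun.dim (poly_ball R n :: (real ^ 'n \<Rightarrow> complex) set)"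

text \<open>
  A real-valued orthonormal polynomial basis of the real $L^2$ space of the ball, ordered by degree.
  The numbering starts from 0: the basis functions are \<open>\<phi> 0, \<phi> 1, \<dots>\<close>.
\<close>

definition poly_onb :: "real \<Rightarrow> (nat \<Rightarrow> real ^ 'n \<Rightarrow> real) \<Rightarrow> bool" where
  "poly_onb R \<phi> \<longleftrightarrow>
     (\<forall>k. \<phi> k \<in> borel_measurable (ball_measure R) \<and> integrable (ball_measure R) (\<lambda>x. (\<phi> k x)\<^sup>2)) \<and>
     (\<forall>j k. (\<integral>x. \<phi> j x * \<phi> k x \<partial>ball_measure R) = (if j = k then 1 else 0)) \<and>
     (\<forall>f \<in> borel_measurable (ball_measure R). integrable (ball_measure R) (\<lambda>x. (f x)\<^sup>2) \<longrightarrow>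
        (\<lambda>N. \<integral>x. (f x - (\<Sum>k<N. (\<integral>y. f y * \<phi> k y \<partial>ball_measure R) * \<phi> k x))\<^sup>2 \<partial>ball_measure R)
          \<longlonglongrightarrow> 0) \<and>
     (\<forall>n. cfun.span ((\<lambda>k. restrict0 (cball 0 R) (\<lambda>x. complex_of_real (\<phi> k x))) ` {..<poly_dim TYPE('n) R n})
          = poly_ball R n)"

text \<open>\<open>onb_proj R \<phi> r q\<close> is the sum of $\langle q, \phi_k\rangle\,\phi_k$ over the first \<open>r\<close> basis functions.\<close>

definition onb_proj ::
    "real \<Rightarrow> (nat \<Rightarrow> real ^ 'n \<Rightarrow> real) \<Rightarrow> nat \<Rightarrow> (real ^ 'n \<Rightarrow> complex) set \<Rightarrow> (real ^ 'n \<Rightarrow> complex) set" where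
  "onb_proj R \<phi> r q = L2_class (ball_measure R)
     (\<lambda>x. \<Sum>k<r. L2_inner (ball_measure R) q (L2_class (ball_measure R) (\<lambda>y. complex_of_real (\<phi> k y)))
            * complex_of_real (\<phi> k x))"


section \<open>Reconstruction error\<close>

text \<open>
  \<open>euclid p\<close> is the space of real \<open>p\<close>-tuples; \<open>p\<close> depends on the polynomial degree, over
  which the theorem quantifies, so it cannot be a type.
\<close>

abbreviation euclid :: "nat \<Rightarrow> (nat \<Rightarrow> real) set" where
  "euclid p \<equiv> {..<p} \<rightarrow>\<^sub>E UNIV"

definition recon_error ::
    "'a measure \<Rightarrow> ('a \<Rightarrow> complex) set measure \<Rightarrow> (('a \<Rightarrow> complex) set \<Rightarrow> ('a \<Rightarrow> complex) set) \<Rightarrow> real" where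
  "recon_error M \<nu> F = sqrt (\<integral>v. (L2_dist M (F v) v)\<^sup>2 \<partial>\<nu>)"

end

theory Submission
  imports Defs
begin

text \<open>
  Let \<open>U \<in> H\<^sup>s(\<real>\<^sup>d)\<close> extend a function on the ball, and let \<open>h\<close> be the error of its orthogonal projection
  onto the polynomials of degree at most \<open>n\<close>, extended by zero. Then \<open>\<parallel>h\<parallel>\<^sup>2 = \<langle>U, h\<rangle>\<close>, which by Parseval is a
  pairing of the Fourier transforms of \<open>U\<close> and \<open>h\<close>. The weight \<open>(1 + |\<xi>|\<^sup>2)\<^sup>s\<close> is absorbed by \<open>U\<close>. At frequencies
  below a small multiple of \<open>n + 1\<close> the transform of \<open>h\<close> is exponentially small, because \<open>h\<close> is orthogonal to
  the Taylor polynomials of the characters; above, the weight gains the factor \<open>(n + 1)\<^sup>-\<^sup>s\<close>. Hence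
  \<open>\<parallel>h\<parallel> \<le> K (n + 1)\<^sup>-\<^sup>s \<parallel>U\<parallel>\<close> for every real \<open>s > 0\<close>, without interpolation, and it remains to note that the space
  of polynomials has dimension at most \<open>(n + 1)\<^sup>d\<close> and that almost every point of a separable metric space
  lies in the support of a Borel measure.
\<close>

section \<open>The space $L^2$ and Gaussian kernels\<close>

text \<open>The exponent s is an arbitrary positive real and \<open>Hs_ball_norm\<close> is an
  infimum over extensions, so the estimate is made by duality for one arbitrary extension U and the
  infimum is taken last; no polynomial close to U is ever constructed. The obstacle is regularity.
  Extended by zero, h may jump across the sphere, so its transform is merely square-integrable,
  while the transform of U exists only as an L^2 limit of truncated integrals. Parseval is therefore
  needed in a form that asks for no smoothness and no integrability of U; Gaussian weights make
  Fubini legitimate, and density and truncation remove every auxiliary assumption. The frequency cut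
  m / (e^2 R) with m = n + 1 is dictated by the Taylor remainder: there it is at most e^(-2m) m^m /
  m! \<le> e^(-m), which beats both the volume of the low-frequency ball, of order m^d, and the
  target power of m. Passing from n to p costs the factor 2^(s/d), because p = 2r \<le> 2 (n +
  1)^d.\<close>

lemma cnj_measurable [measurable]: "cnj \<in> borel_measurable borel"
  by (intro borel_measurable_continuous_onI continuous_intros)

lemma cis_measurable [measurable]: "cis \<in> borel_measurable borel"
  unfolding cis_conv_exp[abs_def] by (intro borel_measurable_continuous_onI continuous_intros)

section \<open>Cauchy-Schwarz and finite sums in L^2\<close>

lemma L2_fun_mult_integrable:
  assumes f: "f \<in> L2_fun M" and g: "g \<in> L2_fun M"
  shows "integrable M (\<lambda>x. f x * cnj (g x))"
proof -
  note [measurable] = L2_fun_measurable[OF f] L2_fun_measurable[OF g]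
  have "integrable M (\<lambda>x. (cmod (f x))\<^sup>2 + (cmod (g x))\<^sup>2)"
    using L2_fun_integrable[OF f] L2_fun_integrable[OF g] by simp
  moreover have "cmod (f x) * cmod (g x) \<le> (cmod (f x))\<^sup>2 + (cmod (g x))\<^sup>2" for x
    using sum_squares_bound[of "cmod (f x)" "cmod (g x)"]
      mult_nonneg_nonneg[OF norm_ge_zero norm_ge_zero, of "f x" "g x"] by linarith
  ultimately show ?thesis
    by (elim Bochner_Integration.integrable_bound) (auto simp: norm_mult)
qed

lemma L2_fun_scale: "f \<in> L2_fun M \<Longrightarrow> (\<lambda>x. c * f x) \<in> L2_fun M"
  by (auto simp: L2_fun_def norm_mult power_mult_distrib)

lemma L2_fnorm_scale: "L2_fnorm M (\<lambda>x. c * f x) = cmod c * L2_fnorm M f"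
  by (simp add: L2_fnorm_def norm_mult power_mult_distrib real_sqrt_mult)

lemma L2_fun_sum: "(\<And>i. i \<in> I \<Longrightarrow> f i \<in> L2_fun M) \<Longrightarrow> (\<lambda>x. \<Sum>i\<in>I. f i x) \<in> L2_fun M"
  by (induction I rule: infinite_finite_induct) (auto intro: L2_fun_add, auto simp: L2_fun_def)

lemma L2_fnorm_sum_le:
  assumes "\<And>i. i \<in> I \<Longrightarrow> f i \<in> L2_fun M"
  shows "L2_fnorm M (\<lambda>x. \<Sum>i\<in>I. f i x) \<le> (\<Sum>i\<in>I. L2_fnorm M (f i))"
  using assms
proof (induction I rule: infinite_finite_induct)
  case (insert i I)
  then show ?case
    using L2_fnorm_triangle[of "f i" M "\<lambda>x. \<Sum>i\<in>I. f i x"] L2_fun_sum[of I f M] by fastforce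
qed (auto simp: L2_fnorm_def)

text \<open>Lifts the squared inequality for nonnegative integrals to Bochner integrals. The moduli
  stay inside the integral because this stronger form also bounds an L^1 norm by an L^2
  norm.\<close>

lemma L2_abs_Cauchy_Schwarz:
  assumes f: "f \<in> L2_fun M" and g: "g \<in> L2_fun M"
  shows "(\<integral>x. cmod (f x) * cmod (g x) \<partial>M) \<le> L2_fnorm M f * L2_fnorm M g"
proof -
  note [measurable] = L2_fun_measurable[OF f] L2_fun_measurable[OF g]
  have int: "integrable M (\<lambda>x. cmod (f x) * cmod (g x))"
    using integrable_norm[OF L2_fun_mult_integrable[OF f g]] by (simp add: norm_mult)
  let ?I = "\<integral>x. cmod (f x) * cmod (g x) \<partial>M"
  have nn: "(\<integral>\<^sup>+x. ennreal (cmod (h x)) ^ 2 \<partial>M) = ennreal ((L2_fnorm M h)\<^sup>2)" if "h \<in> L2_fun M" for h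
    using nn_integral_eq_integral[OF L2_fun_integrable[OF that]]
    by (simp add: L2_fnorm_square ennreal_power)
  have "ennreal (?I\<^sup>2) = (\<integral>\<^sup>+x. ennreal (cmod (f x)) * ennreal (cmod (g x)) \<partial>M)\<^sup>2"
    using nn_integral_eq_integral[OF int] by (simp add: ennreal_mult ennreal_power)
  also have "\<dots> \<le> ennreal ((L2_fnorm M f)\<^sup>2) * ennreal ((L2_fnorm M g)\<^sup>2)"
    unfolding nn[OF f, symmetric] nn[OF g, symmetric] by (intro Cauchy_Schwarz_nn_integral) auto
  also have "\<dots> = ennreal ((L2_fnorm M f * L2_fnorm M g)\<^sup>2)"
    by (simp add: ennreal_mult power_mult_distrib)
  finally have "?I\<^sup>2 \<le> (L2_fnorm M f * L2_fnorm M g)\<^sup>2" by simp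
  then show ?thesis
    by (rule power2_le_imp_le) (simp add: L2_fnorm_nonneg)
qed

lemma L2_Cauchy_Schwarz:
  assumes f: "f \<in> L2_fun M" and g: "g \<in> L2_fun M"
  shows "cmod (\<integral>x. f x * cnj (g x) \<partial>M) \<le> L2_fnorm M f * L2_fnorm M g"
proof -
  have "cmod (\<integral>x. f x * cnj (g x) \<partial>M) \<le> (\<integral>x. cmod (f x) * cmod (g x) \<partial>M)"
    using integral_norm_bound[of M "\<lambda>x. f x * cnj (g x)"] by (simp add: norm_mult)
  with L2_abs_Cauchy_Schwarz[OF f g] show ?thesis by linarith
qed

section \<open>Product integrals and Gaussian kernels\<close>

lemma
  fixes f :: "'a::euclidean_space \<Rightarrow> real \<Rightarrow> 'b::{real_normed_field,banach,second_countable_topology}"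
  assumes int: "\<And>b. b \<in> Basis \<Longrightarrow> integrable lborel (f b)"
  shows integrable_lborel_prod: "integrable lborel (\<lambda>x. \<Prod>b\<in>Basis. f b (x \<bullet> b))"
    and integral_lborel_prod: "(\<integral>x. (\<Prod>b\<in>Basis. f b (x \<bullet> b)) \<partial>lborel) = (\<Prod>b\<in>Basis. \<integral>t. f b t \<partial>lborel)"
proof -
  interpret product_sigma_finite "\<lambda>_::'a. lborel :: real measure" ..
  have [measurable]: "f b \<in> borel_measurable borel" if "b \<in> Basis" for b
    using int[OF that] by auto
  have [measurable]: "(\<lambda>x. \<Prod>b\<in>Basis. f b (x \<bullet> b)) \<in> borel_measurable borel"
    by measurable
  have eq: "(\<Prod>b\<in>Basis. f b ((\<Sum>c\<in>Basis. x c *\<^sub>R c) \<bullet> b)) = (\<Prod>b\<in>Basis. f b (x b))" for x :: "'a \<Rightarrow> real"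
    by (intro prod.cong) auto
  have meas: "(\<lambda>x. \<Sum>c\<in>Basis. x c *\<^sub>R c) \<in> measurable (\<Pi>\<^sub>M b\<in>Basis. (lborel :: real measure)) (borel :: 'a measure)"
    by measurable
  show "integrable lborel (\<lambda>x. \<Prod>b\<in>Basis. f b (x \<bullet> b))"
    by (subst lborel_eq, subst integrable_distr_eq[OF meas])
       (use product_integrable_prod[OF finite_Basis int] in \<open>auto simp: eq\<close>)
  show "(\<integral>x. (\<Prod>b\<in>Basis. f b (x \<bullet> b)) \<partial>lborel) = (\<Prod>b\<in>Basis. \<integral>t. f b t \<partial>lborel)"
    by (subst lborel_eq, subst integral_distr[OF meas])
       (use product_integral_prod[OF finite_Basis int] in \<open>auto simp: eq\<close>)
qed

text \<open>The joint density of independent centred normal variables of standard deviation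
  \<epsilon>, one per coordinate. The product form lets every integral factor into one-dimensional
  ones.\<close>

definition gauss :: "real \<Rightarrow> 'a::euclidean_space \<Rightarrow> real" where
  "gauss \<epsilon> z = (\<Prod>b\<in>Basis. normal_density 0 \<epsilon> (z \<bullet> b))"

lemma gauss_nonneg: "\<epsilon> > 0 \<Longrightarrow> 0 \<le> gauss \<epsilon> z"
  unfolding gauss_def by (intro prod_nonneg) auto

lemma gauss_measurable [measurable]: "gauss \<epsilon> \<in> borel_measurable borel"
  unfolding gauss_def[abs_def] by measurable

lemma gauss_minus: "gauss \<epsilon> (x - y) = gauss \<epsilon> (y - x)"
  unfolding gauss_def by (intro prod.cong) (auto simp: normal_density_def inner_diff_left power2_commute)

lemma gauss_integrable: "\<epsilon> > 0 \<Longrightarrow> integrable lborel (gauss \<epsilon>)"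
  unfolding gauss_def[abs_def] by (intro integrable_lborel_prod) auto

lemma gauss_integral: "\<epsilon> > 0 \<Longrightarrow> (\<integral>z. gauss \<epsilon> (z::'a::euclidean_space) \<partial>lborel) = 1"
  unfolding gauss_def[abs_def] by (subst integral_lborel_prod) (auto simp: integral_normal_density)

lemma gauss_scale:
  assumes "\<epsilon> > 0"
  shows "gauss \<epsilon> (\<epsilon> *\<^sub>R (z::'a::euclidean_space)) = gauss 1 z / \<epsilon> ^ DIM('a)"
proof -
  have "normal_density 0 \<epsilon> (\<epsilon> * t) = normal_density 0 1 t / \<epsilon>" for t
    using assms by (simp add: normal_density_def real_sqrt_mult field_simps power_mult_distrib)
  then show ?thesis
    by (simp add: gauss_def prod_dividef)
qed

text \<open>Substitute \<open>y = x - \<epsilon> *\<^sub>R z\<close>: the kernel becomes fixed and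
  \<epsilon> moves into the argument of \<open>k\<close>, the form in which dominated convergence
  applies as \<epsilon> tends to 0.\<close>

lemma integral_gauss_convolution:
  fixes k :: "'a::euclidean_space \<Rightarrow> complex"
  assumes e: "\<epsilon> > 0" and [measurable]: "k \<in> borel_measurable borel"
  shows "(\<integral>y. k y * gauss \<epsilon> (x - y) \<partial>lborel) = (\<integral>z. k (x - \<epsilon> *\<^sub>R z) * gauss 1 z \<partial>lborel)"
proof -
  have "(\<integral>y. k y * gauss \<epsilon> (x - y) \<partial>lborel) =
      (\<integral>y. k y * gauss \<epsilon> (x - y) \<partial>density (distr lborel borel (\<lambda>y. x + (-\<epsilon>) *\<^sub>R y)) (\<lambda>_. ennreal (\<bar>- \<epsilon>\<bar> ^ DIM('a))))"
    using lborel_affine[of "-\<epsilon>" x] e by (simp flip: ennreal_power)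
  also have "\<dots> = (\<integral>z. \<epsilon> ^ DIM('a) *\<^sub>R (k (x - \<epsilon> *\<^sub>R z) * gauss \<epsilon> (\<epsilon> *\<^sub>R z)) \<partial>lborel)"
    using e by (subst integral_density) (auto simp: integral_distr)
  also have "\<dots> = (\<integral>z. k (x - \<epsilon> *\<^sub>R z) * gauss 1 z \<partial>lborel)"
    using e by (intro Bochner_Integration.integral_cong) (auto simp: gauss_scale scaleR_conv_of_real)
  finally show ?thesis .
qed

text \<open>Up to a constant the weight is a normal density of standard deviation
  \<open>1/\<epsilon>\<close>, so its transform follows from the characteristic function of the
  standard normal law by rescaling \<open>t = u/\<epsilon>\<close>.\<close>

lemma
  assumes e: "\<epsilon> > 0"
  shows gauss_char_integrable: "integrable lborel (\<lambda>t. complex_of_real (exp (-(\<epsilon> * t)\<^sup>2 / 2)) * cis (z * t))"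
    and gauss_char: "(\<integral>t. complex_of_real (exp (-(\<epsilon> * t)\<^sup>2 / 2)) * cis (z * t) \<partial>lborel) = complex_of_real (2 * pi * normal_density 0 \<epsilon> z)"
proof -
  let ?g = "\<lambda>t. complex_of_real (normal_density 0 (1/\<epsilon>) t) * cis (z * t)"
  have nd: "exp (-(\<epsilon> * t)\<^sup>2 / 2) = sqrt (2 * pi) / \<epsilon> * normal_density 0 (1/\<epsilon>) t" for t
  proof -
    have "sqrt (2 * pi * (1 / \<epsilon>)\<^sup>2) = sqrt (2 * pi) / \<epsilon>"
      using e by (simp add: real_sqrt_mult)
    moreover have "- (t - 0)\<^sup>2 / (2 * (1 / \<epsilon>)\<^sup>2) = -(\<epsilon> * t)\<^sup>2 / 2"
      using e by (simp add: power_divide power_mult_distrib)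
    ultimately show ?thesis using e by (simp only: normal_density_def) simp
  qed
  have eq: "complex_of_real (exp (-(\<epsilon> * t)\<^sup>2 / 2)) * cis (z * t) = complex_of_real (sqrt (2 * pi) / \<epsilon>) * ?g t" for t
    by (simp only: nd of_real_mult mult.assoc)
  have "integrable lborel (\<lambda>t. normal_density 0 (1/\<epsilon>) t)"
    using e by (intro integrable_normal_density) auto
  then have "integrable lborel ?g"
    by (rule Bochner_Integration.integrable_bound) (auto simp: norm_mult)
  then show "integrable lborel (\<lambda>t. complex_of_real (exp (-(\<epsilon> * t)\<^sup>2 / 2)) * cis (z * t))"
    unfolding eq by simp
  have ch: "(\<integral>u. complex_of_real (std_normal_density u) * cis (s * u) \<partial>lborel) = complex_of_real (exp (- s\<^sup>2 / 2))" for s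
    using char_std_normal_distribution[THEN fun_cong, of s]
    by (simp add: char_def integral_density scaleR_conv_of_real cis_conv_exp mult.assoc)
  have "(\<integral>t. complex_of_real (exp (-(\<epsilon> * t)\<^sup>2 / 2)) * cis (z * t) \<partial>lborel)
      = \<bar>1/\<epsilon>\<bar> *\<^sub>R (\<integral>u. complex_of_real (exp (-(\<epsilon> * (0 + 1/\<epsilon> * u))\<^sup>2 / 2)) * cis (z * (0 + 1/\<epsilon> * u)) \<partial>lborel)"
    using e by (intro lborel_integral_real_affine) auto
  also have "\<dots> = \<bar>1/\<epsilon>\<bar> *\<^sub>R (\<integral>u. complex_of_real (sqrt (2*pi)) * (complex_of_real (std_normal_density u) * cis (z / \<epsilon> * u)) \<partial>lborel)"
    using e by (intro arg_cong[of _ _ "(*\<^sub>R) _"] Bochner_Integration.integral_cong) (auto simp: std_normal_density_def)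
  also have "\<dots> = complex_of_real (sqrt (2 * pi) / \<epsilon> * exp (- (z / \<epsilon>)\<^sup>2 / 2))"
    unfolding integral_mult_right_zero ch using e by (simp add: scaleR_conv_of_real)
  also have "sqrt (2 * pi) / \<epsilon> * exp (- (z / \<epsilon>)\<^sup>2 / 2) = 2 * pi * normal_density 0 \<epsilon> z"
  proof -
    have "sqrt (2 * pi * \<epsilon>\<^sup>2) = sqrt (2 * pi) * \<epsilon>" using e by (simp add: real_sqrt_mult)
    moreover have "- (z - 0)\<^sup>2 / (2 * \<epsilon>\<^sup>2) = -(z / \<epsilon>)\<^sup>2 / 2"
      by (simp add: power_divide)
    moreover have "sqrt (2 * pi) / \<epsilon> = 2 * pi * (1 / (sqrt (2 * pi) * \<epsilon>))"
      using e by (simp add: field_simps)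
    ultimately show ?thesis by (simp only: normal_density_def mult.assoc)
  qed
  finally show "(\<integral>t. complex_of_real (exp (-(\<epsilon> * t)\<^sup>2 / 2)) * cis (z * t) \<partial>lborel) = complex_of_real (2 * pi * normal_density 0 \<epsilon> z)" .
qed

lemma cis_sum: "cis (\<Sum>i\<in>I. f i) = (\<Prod>i\<in>I. cis (f i))"
  by (induction I rule: infinite_finite_induct) (auto simp flip: cis_mult)

lemma gauss_weight_prod:
  "complex_of_real (exp (-(\<epsilon> * norm (\<xi>::'a::euclidean_space))\<^sup>2 / 2)) * cis (z \<bullet> \<xi>)
    = (\<Prod>b\<in>Basis. complex_of_real (exp (-(\<epsilon> * (\<xi> \<bullet> b))\<^sup>2 / 2)) * cis ((z \<bullet> b) * (\<xi> \<bullet> b)))"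
proof -
  have "-(\<epsilon> * norm \<xi>)\<^sup>2 / 2 = (\<Sum>b\<in>Basis. -(\<epsilon> * (\<xi> \<bullet> b))\<^sup>2 / 2)"
    unfolding power_mult_distrib power2_norm_eq_inner euclidean_inner[of \<xi> \<xi>]
    by (simp add: sum_distrib_left sum_divide_distrib sum_negf power2_eq_square)
  then show ?thesis
    by (simp add: exp_sum prod.distrib cis_sum euclidean_inner[of z \<xi>])
qed

text \<open>The integral factors over the coordinates. The power of \<open>2 * pi\<close> is exactly
  what the normalising factors of two Fourier transforms cancel later.\<close>

lemma
  fixes z :: "'a::euclidean_space"
  assumes e: "\<epsilon> > 0"
  shows gauss_weight_integrable: "integrable lborel (\<lambda>\<xi>::'a. complex_of_real (exp (-(\<epsilon> * norm \<xi>)\<^sup>2 / 2)) * cis (z \<bullet> \<xi>))"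
    and gauss_weight_integral: "(\<integral>\<xi>. complex_of_real (exp (-(\<epsilon> * norm \<xi>)\<^sup>2 / 2)) * cis (z \<bullet> \<xi>) \<partial>lborel)
       = complex_of_real ((2 * pi) ^ DIM('a) * gauss \<epsilon> z)"
  unfolding gauss_weight_prod
  using integrable_lborel_prod[OF gauss_char_integrable[OF e], of "\<lambda>b. z \<bullet> b"]
    integral_lborel_prod[OF gauss_char_integrable[OF e], of "\<lambda>b. z \<bullet> b"]
  unfolding gauss_char[OF e] by (simp_all add: gauss_def prod.distrib)

section \<open>Fourier transform and Parseval identity\<close>

text \<open>The classical transform, kept apart from the L^2 limit in \<open>has_fourier\<close>:
  for integrable \<open>f\<close> it is an honest integral at every frequency, to which Fubini
  applies. The normalisation agrees with that of \<open>fourier_trunc\<close>.\<close>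

definition fourier :: "('a::euclidean_space \<Rightarrow> complex) \<Rightarrow> 'a \<Rightarrow> complex" where
  "fourier f \<xi> = complex_of_real ((2 * pi) powr (- real DIM('a) / 2)) * (\<integral>x. cis (- (x \<bullet> \<xi>)) * f x \<partial>lborel)"

lemma fourier_measurable [measurable]:
  assumes [measurable]: "f \<in> borel_measurable borel"
  shows "fourier f \<in> borel_measurable borel"
  unfolding fourier_def[abs_def] by measurable

lemma cis_mult_integrable:
  assumes f: "integrable lborel (f :: 'a::euclidean_space \<Rightarrow> complex)"
  shows "integrable lborel (\<lambda>x. cis (- (x \<bullet> \<xi>)) * f x)"
proof -
  have [measurable]: "f \<in> borel_measurable borel" using f by auto
  show ?thesis
    by (rule Bochner_Integration.integrable_bound[OF f]) (auto simp: norm_mult)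
qed

lemma fourier_diff:
  assumes "integrable lborel f" "integrable lborel g"
  shows "fourier (\<lambda>x. f x - g x) \<xi> = fourier f \<xi> - fourier g \<xi>"
  using cis_mult_integrable[OF assms(1), of \<xi>] cis_mult_integrable[OF assms(2), of \<xi>]
  by (simp add: fourier_def right_diff_distrib)

lemma integrable_tensor:
  fixes f :: "'a::euclidean_space \<Rightarrow> complex" and g :: "'b::euclidean_space \<Rightarrow> complex"
  assumes f: "integrable lborel f" and g: "integrable lborel g"
  shows "integrable (lborel \<Otimes>\<^sub>M lborel) (\<lambda>(x, y). f x * g y)"
proof -
  have [measurable]: "f \<in> borel_measurable borel" "g \<in> borel_measurable borel" using f g by auto
  show ?thesis
    by (rule lborel_pair.Fubini_integrable) (use f g in \<open>auto simp: norm_mult\<close>)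
qed

section \<open>Gaussian regularisation of Fourier pairings\<close>

lemma gauss_shift_integral:
  fixes x :: "'a::euclidean_space"
  assumes "\<epsilon> > 0"
  shows "integrable lborel (\<lambda>y. gauss \<epsilon> (x - y))" "(\<integral>y. gauss \<epsilon> (x - y) \<partial>lborel) = (1::real)"
proof -
  show "integrable lborel (\<lambda>y. gauss \<epsilon> (x - y))"
  proof -
    have "integrable (distr lborel borel ((+) (- x))) (gauss \<epsilon>)"
      using gauss_integrable[OF assms] by (simp only: lborel_distr_plus)
    then show ?thesis
      by (simp add: integrable_distr_eq gauss_minus[of _ x])
  qed
  have "complex_of_real (\<integral>y. gauss \<epsilon> (x - y) \<partial>lborel) = complex_of_real 1"
    using integral_gauss_convolution[OF assms, of "\<lambda>_. 1" x] gauss_integral[of 1, where 'a='a]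
    by simp
  then show "(\<integral>y. gauss \<epsilon> (x - y) \<partial>lborel) = 1" by (simp only: of_real_eq_iff)
qed

text \<open>The kernel has mass 1 in either variable, so integrating the other variable out leaves
  \<open>k\<close>. The two marginals are the ingredients of a Schur test for Gaussian
  smoothing.\<close>

lemma
  assumes e: "\<epsilon> > 0" and k: "integrable lborel (k :: 'a::euclidean_space \<Rightarrow> real)"
  shows integrable_gauss_fst: "integrable (lborel \<Otimes>\<^sub>M lborel) (\<lambda>(x, y). k x * gauss \<epsilon> (x - y))" (is ?A)
    and integral_gauss_fst: "(\<integral>(x, y). k x * gauss \<epsilon> (x - y) \<partial>(lborel \<Otimes>\<^sub>M lborel)) = (\<integral>x. k x \<partial>lborel)"
    and integrable_gauss_snd: "integrable (lborel \<Otimes>\<^sub>M lborel) (\<lambda>(x, y). k y * gauss \<epsilon> (x - y))"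
    and integral_gauss_snd: "(\<integral>(x, y). k y * gauss \<epsilon> (x - y) \<partial>(lborel \<Otimes>\<^sub>M lborel)) = (\<integral>x. k x \<partial>lborel)"
proof -
  have [measurable]: "k \<in> borel_measurable borel" using k by auto
  show int: ?A
    by (rule lborel_pair.Fubini_integrable)
       (use k in \<open>auto simp: abs_mult gauss_nonneg[OF e] gauss_shift_integral[OF e]\<close>)
  show eq: "(\<integral>(x, y). k x * gauss \<epsilon> (x - y) \<partial>(lborel \<Otimes>\<^sub>M lborel)) = (\<integral>x. k x \<partial>lborel)"
    using lborel_pair.integral_fst[OF int] by (simp add: gauss_shift_integral[OF e])
  show "integrable (lborel \<Otimes>\<^sub>M lborel) (\<lambda>(x, y). k y * gauss \<epsilon> (x - y))"
    using lborel_pair.integrable_product_swap[OF int] by (simp add: gauss_minus case_prod_unfold)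
  show "(\<integral>(x, y). k y * gauss \<epsilon> (x - y) \<partial>(lborel \<Otimes>\<^sub>M lborel)) = (\<integral>x. k x \<partial>lborel)"
    using lborel_pair.integral_product_swap[OF borel_measurable_integrable[OF int]] eq
    by (simp add: case_prod_unfold gauss_minus[of _ "fst _"])
qed

text \<open>The Gaussian weight makes Fubini applicable to the product of two Fourier integrals.\<close>

lemma
  fixes f h :: "'a::euclidean_space \<Rightarrow> complex"
  assumes e: "\<epsilon> > 0" and f: "integrable lborel f" and h: "integrable lborel h"
  shows integrable_fourier_gauss: "integrable lborel (\<lambda>\<xi>. complex_of_real (exp (-(\<epsilon> * norm \<xi>)\<^sup>2 / 2)) * (fourier f \<xi> * cnj (fourier h \<xi>)))"
    and integrable_pairing_gauss: "integrable (lborel \<Otimes>\<^sub>M lborel) (\<lambda>(x, y). f x * cnj (h y) * gauss \<epsilon> (x - y))"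
    and integral_fourier_gauss: "(\<integral>\<xi>. complex_of_real (exp (-(\<epsilon> * norm \<xi>)\<^sup>2 / 2)) * (fourier f \<xi> * cnj (fourier h \<xi>)) \<partial>lborel)
      = (\<integral>(x, y). f x * cnj (h y) * gauss \<epsilon> (x - y) \<partial>(lborel \<Otimes>\<^sub>M lborel))"
proof -
  have [measurable]: "f \<in> borel_measurable borel" "h \<in> borel_measurable borel" using f h by auto
  define c where "c = (2 * pi) powr (- real DIM('a) / 2)"
  \<comment> \<open>Two normalising factors meet the factor \<open>(2 * pi) ^ DIM('a)\<close>
    produced by the transform of the Gaussian weight.\<close>
  have c2: "c * c * (2 * pi) ^ DIM('a) = 1"
  proof -
    have "c * c = (2 * pi) powr (- real DIM('a))" by (simp add: c_def flip: powr_add)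
    then show ?thesis by (simp add: powr_minus powr_realpow field_simps)
  qed
  have hc: "integrable lborel (\<lambda>y. cnj (h y))" using h by simp
  \<comment> \<open>Both space variables are bundled into one point of the product space, so a
    single application of Fubini, between the frequency and this point, suffices.\<close>
  define p where "p = (\<lambda>z. f (fst z) * cnj (h (snd z)))"
  have p: "integrable lborel p"
    using integrable_tensor[OF f hc] by (simp add: p_def case_prod_unfold lborel_prod)
  have [measurable]: "p \<in> borel_measurable borel" using p by auto
  define W where "W = (\<lambda>\<xi>::'a. complex_of_real (exp (-(\<epsilon> * norm \<xi>)\<^sup>2 / 2)))"
  have [measurable]: "W \<in> borel_measurable borel" unfolding W_def by measurable
  have W: "integrable lborel W"
    using gauss_weight_integrable[OF e, of "0::'a"] by (simp add: W_def)
  have [measurable]: "(\<lambda>z::'a \<times> 'a. snd z - fst z) \<in> borel_measurable borel"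
    by (intro borel_measurable_continuous_onI continuous_intros)
  have "integrable (lborel \<Otimes>\<^sub>M lborel) (\<lambda>(\<xi>, z). W \<xi> * p z)"
    by (rule integrable_tensor[OF W p])
  then have F: "integrable (lborel \<Otimes>\<^sub>M lborel) (\<lambda>(\<xi>, z). W \<xi> * p z * cis ((snd z - fst z) \<bullet> \<xi>))"
    by (rule Bochner_Integration.integrable_bound) (auto simp: norm_mult)
  \<comment> \<open>The same triple integral is read in two orders: integrating out space gives the
    product of the transforms, and integrating out the frequency gives the Gaussian kernel in
    \<open>inner\<close>.\<close>
  have prod: "(\<integral>z. W \<xi> * p z * cis ((snd z - fst z) \<bullet> \<xi>) \<partial>lborel) * complex_of_real (c * c) = W \<xi> * (fourier f \<xi> * cnj (fourier h \<xi>))" for \<xi>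
  proof -
    have fx: "integrable lborel (\<lambda>x. cis (- (x \<bullet> \<xi>)) * f x)" by (rule cis_mult_integrable[OF f])
    have hy: "integrable lborel (\<lambda>x. cnj (cis (- (x \<bullet> \<xi>)) * h x))"
      using cis_mult_integrable[OF h, of \<xi>] by (simp only: integrable_cnj)
    have eq: "p (x, y) * cis ((snd (x, y) - fst (x, y)) \<bullet> \<xi>) = (cis (- (x \<bullet> \<xi>)) * f x) * cnj (cis (- (y \<bullet> \<xi>)) * h y)" for x y
    proof -
      have "cis ((y - x) \<bullet> \<xi>) = cis (- (x \<bullet> \<xi>)) * cis (y \<bullet> \<xi>)"
        by (simp add: cis_mult inner_diff_left)
      then show ?thesis by (simp add: p_def cis_cnj)
    qed
    have "(\<integral>z. p z * cis ((snd z - fst z) \<bullet> \<xi>) \<partial>lborel)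
        = (\<integral>(x, y). (cis (- (x \<bullet> \<xi>)) * f x) * cnj (cis (- (y \<bullet> \<xi>)) * h y) \<partial>(lborel \<Otimes>\<^sub>M lborel))"
      unfolding lborel_prod by (intro Bochner_Integration.integral_cong) (auto simp only: eq[symmetric] split: prod.splits)
    also have "\<dots> = (\<integral>x. cis (- (x \<bullet> \<xi>)) * f x \<partial>lborel) * cnj (\<integral>y. cis (- (y \<bullet> \<xi>)) * h y \<partial>lborel)"
      unfolding lborel_pair.integral_fst[OF integrable_tensor[OF fx hy], symmetric]
      by (simp only: integral_mult_right_zero integral_mult_left_zero Bochner_Integration.integral_cnj)
    finally show ?thesis
      by (simp add: fourier_def c_def mult.assoc mult.left_commute mult.commute)
  qed
  have inner: "(\<integral>\<xi>. W \<xi> * p z * cis ((snd z - fst z) \<bullet> \<xi>) \<partial>lborel) * complex_of_real (c * c) = p z * gauss \<epsilon> (fst z - snd z)" for z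
  proof -
    have "(\<integral>\<xi>. W \<xi> * p z * cis ((snd z - fst z) \<bullet> \<xi>) \<partial>lborel) = (\<integral>\<xi>. p z * (W \<xi> * cis ((snd z - fst z) \<bullet> \<xi>)) \<partial>lborel)"
      by (simp add: mult_ac)
    also have "\<dots> = p z * complex_of_real ((2 * pi) ^ DIM('a) * gauss \<epsilon> (fst z - snd z))"
      using gauss_weight_integral[OF e, of "snd z - fst z"]
      by (simp add: W_def gauss_minus[of \<epsilon> "snd z"])
    finally show ?thesis using c2
      by (simp add: mult_ac flip: of_real_mult of_real_power)
  qed
  show "integrable lborel (\<lambda>\<xi>. complex_of_real (exp (-(\<epsilon> * norm \<xi>)\<^sup>2 / 2)) * (fourier f \<xi> * cnj (fourier h \<xi>)))"
    using integrable_mult_left[OF lborel_pair.integrable_fst[OF F], of "complex_of_real (c * c)"]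
    unfolding prod by (simp add: W_def)
  have "integrable lborel (\<lambda>z. p z * gauss \<epsilon> (fst z - snd z))"
    using integrable_mult_left[OF lborel_pair.integrable_snd[OF F], of "complex_of_real (c * c)"]
    unfolding inner by simp
  then show "integrable (lborel \<Otimes>\<^sub>M lborel) (\<lambda>(x, y). f x * cnj (h y) * gauss \<epsilon> (x - y))"
    by (simp add: p_def lborel_prod case_prod_unfold)
  have "(\<integral>\<xi>. W \<xi> * (fourier f \<xi> * cnj (fourier h \<xi>)) \<partial>lborel) = (\<integral>z. p z * gauss \<epsilon> (fst z - snd z) \<partial>lborel)"
    unfolding prod[symmetric] inner[symmetric] integral_mult_left_zero
    by (simp only: lborel_pair.Fubini_integral[OF F])
  then show "(\<integral>\<xi>. complex_of_real (exp (-(\<epsilon> * norm \<xi>)\<^sup>2 / 2)) * (fourier f \<xi> * cnj (fourier h \<xi>)) \<partial>lborel)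
      = (\<integral>(x, y). f x * cnj (h y) * gauss \<epsilon> (x - y) \<partial>(lborel \<Otimes>\<^sub>M lborel))"
    by (simp add: p_def W_def lborel_prod case_prod_unfold)
qed

text \<open>The contractive half of Plancherel. The weighted energy of the transform is the pairing
  of \<open>f\<close> with its Gaussian smoothing, which a Schur test bounds by the squared norm
  uniformly in \<epsilon>; Fatou's lemma then removes the weight.\<close>

lemma
  fixes f :: "'a::euclidean_space \<Rightarrow> complex"
  assumes f: "integrable lborel f" and f2: "f \<in> L2_fun lborel"
  shows fourier_L2_fun: "fourier f \<in> L2_fun lborel"
    and L2_fnorm_fourier_le: "L2_fnorm lborel (fourier f) \<le> L2_fnorm lborel f"
proof -
  have [measurable]: "f \<in> borel_measurable borel" using f by auto
  define W where "W = (\<lambda>\<epsilon> (\<xi>::'a). exp (-(\<epsilon> * norm \<xi>)\<^sup>2 / 2) * (cmod (fourier f \<xi>))\<^sup>2)"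
  have Wc: "complex_of_real (W \<epsilon> \<xi>) = complex_of_real (exp (-(\<epsilon> * norm \<xi>)\<^sup>2 / 2)) * (fourier f \<xi> * cnj (fourier f \<xi>))" for \<epsilon> \<xi>
    by (simp add: W_def complex_norm_square[symmetric])
  have k: "integrable lborel (\<lambda>x. (cmod (f x))\<^sup>2)" by (rule L2_fun_integrable[OF f2])
  have W: "(\<integral>\<^sup>+\<xi>. ennreal (W \<epsilon> \<xi>) \<partial>lborel) \<le> ennreal ((L2_fnorm lborel f)\<^sup>2)" if e: "\<epsilon> > 0" for \<epsilon>
  proof -
    have "integrable lborel (\<lambda>\<xi>. complex_of_real (W \<epsilon> \<xi>))"
      unfolding Wc by (rule integrable_fourier_gauss[OF e f f])
    from integrable_Re[OF this] have int: "integrable lborel (W \<epsilon>)" by simp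
    have "\<bar>\<integral>\<xi>. W \<epsilon> \<xi> \<partial>lborel\<bar> = cmod (\<integral>\<xi>. complex_of_real (W \<epsilon> \<xi>) \<partial>lborel)"
      by simp
    also have "\<dots> = cmod (\<integral>(x, y). f x * cnj (f y) * gauss \<epsilon> (x - y) \<partial>(lborel \<Otimes>\<^sub>M lborel))"
      unfolding Wc integral_fourier_gauss[OF e f f] ..
    also have "\<dots> \<le> (\<integral>z. cmod (case z of (x, y) \<Rightarrow> f x * cnj (f y) * gauss \<epsilon> (x - y)) \<partial>(lborel \<Otimes>\<^sub>M lborel))"
      by (rule integral_norm_bound)
    \<comment> \<open>By the arithmetic-geometric mean inequality; each summand integrates, by one
      of the marginals, to half of the squared norm.\<close>
    also have "\<dots> \<le> (\<integral>z. (case z of (x, y) \<Rightarrow> (cmod (f x))\<^sup>2 * gauss \<epsilon> (x - y)) / 2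
        + (case z of (x, y) \<Rightarrow> (cmod (f y))\<^sup>2 * gauss \<epsilon> (x - y)) / 2 \<partial>(lborel \<Otimes>\<^sub>M lborel))"
    proof (rule integral_mono)
      show "integrable (lborel \<Otimes>\<^sub>M lborel) (\<lambda>z. cmod (case z of (x, y) \<Rightarrow> f x * cnj (f y) * gauss \<epsilon> (x - y)))"
        by (rule integrable_norm[OF integrable_pairing_gauss[OF e f f]])
      show "integrable (lborel \<Otimes>\<^sub>M lborel) (\<lambda>z. (case z of (x, y) \<Rightarrow> (cmod (f x))\<^sup>2 * gauss \<epsilon> (x - y)) / 2
        + (case z of (x, y) \<Rightarrow> (cmod (f y))\<^sup>2 * gauss \<epsilon> (x - y)) / 2)"
        using integrable_gauss_fst[OF e k] integrable_gauss_snd[OF e k] by auto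
      fix z :: "'a \<times> 'a"
      obtain x y where z: "z = (x, y)" by force
      have "cmod (f x) * cmod (f y) \<le> ((cmod (f x))\<^sup>2 + (cmod (f y))\<^sup>2) / 2"
        using sum_squares_bound[of "cmod (f x)" "cmod (f y)"] by simp
      from mult_right_mono[OF this gauss_nonneg[OF e, of "x - y"]]
      show "cmod (case z of (x, y) \<Rightarrow> f x * cnj (f y) * gauss \<epsilon> (x - y)) \<le> (case z of (x, y) \<Rightarrow> (cmod (f x))\<^sup>2 * gauss \<epsilon> (x - y)) / 2
        + (case z of (x, y) \<Rightarrow> (cmod (f y))\<^sup>2 * gauss \<epsilon> (x - y)) / 2"
        by (simp add: z norm_mult gauss_nonneg[OF e] algebra_simps add_divide_distrib)
    qed
    also have "\<dots> = (L2_fnorm lborel f)\<^sup>2"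
      using integrable_gauss_fst[OF e k] integrable_gauss_snd[OF e k]
      by (simp add: integral_gauss_fst[OF e k] integral_gauss_snd[OF e k] L2_fnorm_square)
    finally show ?thesis
      using nn_integral_eq_integral[OF int] by (simp add: W_def)
  qed
  define e where "e n = 1 / real (Suc n)" for n
  have e0: "e \<longlonglongrightarrow> 0" unfolding e_def by (rule LIMSEQ_inverse_real_of_nat[unfolded inverse_eq_divide])
  have lim: "(\<lambda>n. W (e n) \<xi>) \<longlonglongrightarrow> (cmod (fourier f \<xi>))\<^sup>2" for \<xi>
  proof -
    have "(\<lambda>n. W (e n) \<xi>) \<longlonglongrightarrow> exp (-(0 * norm \<xi>)\<^sup>2 / 2) * (cmod (fourier f \<xi>))\<^sup>2"
      unfolding W_def by (intro tendsto_intros e0) simp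
    then show ?thesis by simp
  qed
  have "(\<integral>\<^sup>+\<xi>. ennreal ((cmod (fourier f \<xi>))\<^sup>2) \<partial>lborel) = (\<integral>\<^sup>+\<xi>. liminf (\<lambda>n. ennreal (W (e n) \<xi>)) \<partial>lborel)"
    by (intro nn_integral_cong lim_imp_Liminf[symmetric] tendsto_ennrealI lim) simp
  also have "\<dots> \<le> liminf (\<lambda>n. \<integral>\<^sup>+\<xi>. ennreal (W (e n) \<xi>) \<partial>lborel)"
    by (intro nn_integral_liminf) (auto simp: W_def)
  also have "\<dots> \<le> liminf (\<lambda>n::nat. ennreal ((L2_fnorm lborel f)\<^sup>2))"
    by (intro Liminf_mono always_eventually allI W) (auto simp: e_def)
  also have "\<dots> = ennreal ((L2_fnorm lborel f)\<^sup>2)"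
    by (simp add: Liminf_const)
  finally have le: "(\<integral>\<^sup>+\<xi>. ennreal ((cmod (fourier f \<xi>))\<^sup>2) \<partial>lborel) \<le> ennreal ((L2_fnorm lborel f)\<^sup>2)" .
  then have "integrable lborel (\<lambda>\<xi>. (cmod (fourier f \<xi>))\<^sup>2)"
    by (intro integrableI_bounded) (auto simp: le_less_trans)
  then show F: "fourier f \<in> L2_fun lborel" by (simp add: L2_fun_def)
  have "ennreal ((L2_fnorm lborel (fourier f))\<^sup>2) \<le> ennreal ((L2_fnorm lborel f)\<^sup>2)"
    using le nn_integral_eq_integral[OF L2_fun_integrable[OF F]] by (simp add: L2_fnorm_square)
  then show "L2_fnorm lborel (fourier f) \<le> L2_fnorm lborel f"
    by (simp add: L2_fnorm_nonneg)
qed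

text \<open>The second conclusion is uniform in \<open>n\<close> and \<open>x\<close>: it is what
  dominates the smoothed functions when they are integrated against an integrable
  \<open>f\<close>.\<close>

lemma gauss_approximate_identity:
  fixes k :: "'a::euclidean_space \<Rightarrow> complex"
  assumes k: "continuous_on UNIV k" and M: "\<And>x. cmod (k x) \<le> M" and e: "\<And>n. e n > 0" "e \<longlonglongrightarrow> 0"
  shows "(\<lambda>n. \<integral>y. k y * gauss (e n) (x - y) \<partial>lborel) \<longlonglongrightarrow> k x"
    and "cmod (\<integral>y. k y * gauss (e n) (x - y) \<partial>lborel) \<le> M"
proof -
  have [measurable]: "k \<in> borel_measurable borel"
    using k by (rule borel_measurable_continuous_onI)
  have g: "integrable lborel (gauss 1 :: 'a \<Rightarrow> real)" by (rule gauss_integrable) simp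
  have lim: "(\<lambda>n. k (x - e n *\<^sub>R z) * gauss 1 z) \<longlonglongrightarrow> k x * gauss 1 z" for z
  proof -
    have "(\<lambda>n. x - e n *\<^sub>R z) \<longlonglongrightarrow> x - 0 *\<^sub>R z" by (intro tendsto_intros e(2))
    then have "(\<lambda>n. k (x - e n *\<^sub>R z)) \<longlonglongrightarrow> k x"
      using continuous_on_tendsto_compose[OF k, of "\<lambda>n. x - e n *\<^sub>R z" x sequentially] by simp
    then show ?thesis by (intro tendsto_intros)
  qed
  have bd: "cmod (k (x - e n *\<^sub>R z) * gauss 1 z) \<le> M * gauss 1 z" for n z
    using M by (simp add: norm_mult gauss_nonneg mult_right_mono)
  have gM: "integrable lborel (\<lambda>z::'a. M * gauss 1 z)" using g by simp
  have "(\<lambda>n. \<integral>z. k (x - e n *\<^sub>R z) * gauss 1 z \<partial>lborel) \<longlonglongrightarrow> (\<integral>z. k x * gauss 1 (z::'a) \<partial>lborel)"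
    by (rule integral_dominated_convergence[OF _ _ gM]) (use lim bd in auto)
  also have "(\<integral>z. k x * complex_of_real (gauss 1 (z::'a)) \<partial>lborel) = k x"
    by (simp add: gauss_integral)
  finally show "(\<lambda>n. \<integral>y. k y * gauss (e n) (x - y) \<partial>lborel) \<longlonglongrightarrow> k x"
    by (simp add: integral_gauss_convolution e(1))
  have "cmod (\<integral>z. k (x - e n *\<^sub>R z) * gauss 1 z \<partial>lborel) \<le> (\<integral>z. M * gauss 1 (z::'a) \<partial>lborel)"
  proof (rule Bochner_Integration.integral_norm_bound_integral[OF _ gM bd])
    show "integrable lborel (\<lambda>z. k (x - e n *\<^sub>R z) * gauss 1 z)"
      by (rule Bochner_Integration.integrable_bound[OF gM])
         (use bd in \<open>auto intro: order_trans[OF _ abs_ge_self]\<close>)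
  qed
  then show "cmod (\<integral>y. k y * gauss (e n) (x - y) \<partial>lborel) \<le> M"
    by (simp add: integral_gauss_convolution e(1) gauss_integral)
qed

text \<open>For bounded continuous \<open>h\<close> the smoothings converge at every point, so
  dominated convergence applies to both sides of the regularised identity.\<close>

lemma Parseval_continuous:
  fixes f h :: "'a::euclidean_space \<Rightarrow> complex"
  assumes f: "integrable lborel f" "f \<in> L2_fun lborel" and h: "integrable lborel h" "h \<in> L2_fun lborel"
    and cont: "continuous_on UNIV h" and M: "\<And>x. cmod (h x) \<le> M"
  shows "(\<integral>\<xi>. fourier f \<xi> * cnj (fourier h \<xi>) \<partial>lborel) = (\<integral>x. f x * cnj (h x) \<partial>lborel)"
proof (rule LIMSEQ_unique)
  have [measurable]: "f \<in> borel_measurable borel" "h \<in> borel_measurable borel" using f h by auto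
  define e where "e n = 1 / real (Suc n)" for n
  have e: "\<And>n. e n > 0" by (simp add: e_def)
  have e0: "e \<longlonglongrightarrow> 0" unfolding e_def by (rule LIMSEQ_inverse_real_of_nat[unfolded inverse_eq_divide])
  let ?L = "\<lambda>n. \<integral>\<xi>. complex_of_real (exp (-(e n * norm \<xi>)\<^sup>2 / 2)) * (fourier f \<xi> * cnj (fourier h \<xi>)) \<partial>lborel"
  \<comment> \<open>Square-integrability of the two transforms supplies the dominating function,
    since the Gaussian weight is at most 1.\<close>
  have int: "integrable lborel (\<lambda>\<xi>. cmod (fourier f \<xi> * cnj (fourier h \<xi>)))"
    by (intro integrable_norm L2_fun_mult_integrable fourier_L2_fun f h)
  show "?L \<longlonglongrightarrow> (\<integral>\<xi>. fourier f \<xi> * cnj (fourier h \<xi>) \<partial>lborel)"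
  proof (rule integral_dominated_convergence[OF _ _ int])
    have "(\<lambda>n. complex_of_real (exp (-(e n * norm \<xi>)\<^sup>2 / 2)) * (fourier f \<xi> * cnj (fourier h \<xi>)))
        \<longlonglongrightarrow> complex_of_real (exp (-(0 * norm \<xi>)\<^sup>2 / 2)) * (fourier f \<xi> * cnj (fourier h \<xi>))" for \<xi> :: 'a
      by (intro tendsto_intros e0) simp
    then show "AE \<xi> in lborel. (\<lambda>n. complex_of_real (exp (-(e n * norm \<xi>)\<^sup>2 / 2)) * (fourier f \<xi> * cnj (fourier h \<xi>)))
        \<longlonglongrightarrow> fourier f \<xi> * cnj (fourier h \<xi>)" by simp
  qed (auto simp: norm_mult intro!: mult_left_le_one_le)
  have cc: "continuous_on UNIV (\<lambda>x. cnj (h x))" by (intro continuous_intros cont)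
  have cM: "cmod (cnj (h x)) \<le> M" for x using M by simp
  note ai = gauss_approximate_identity[OF cc cM e e0]
  have "?L n = (\<integral>x. f x * (\<integral>y. cnj (h y) * gauss (e n) (x - y) \<partial>lborel) \<partial>lborel)" for n
    unfolding integral_fourier_gauss[OF e f(1) h(1)]
      lborel_pair.integral_fst[OF integrable_pairing_gauss[OF e f(1) h(1)], symmetric]
    by (simp add: mult.assoc)
  moreover have "(\<lambda>n. \<integral>x. f x * (\<integral>y. cnj (h y) * gauss (e n) (x - y) \<partial>lborel) \<partial>lborel) \<longlonglongrightarrow> (\<integral>x. f x * cnj (h x) \<partial>lborel)"
  proof (rule integral_dominated_convergence)
    show "integrable lborel (\<lambda>x. cmod (f x) * M)" using f(1) by simp
    show "AE x in lborel. (\<lambda>n. f x * (\<integral>y. cnj (h y) * gauss (e n) (x - y) \<partial>lborel)) \<longlonglongrightarrow> f x * cnj (h x)"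
      by (intro always_eventually allI tendsto_intros ai(1))
    show "AE x in lborel. cmod (f x * (\<integral>y. cnj (h y) * gauss (e n) (x - y) \<partial>lborel)) \<le> cmod (f x) * M" for n
      using ai(2) by (simp add: norm_mult mult_left_mono)
  qed measurable
  ultimately show "?L \<longlonglongrightarrow> (\<integral>x. f x * cnj (h x) \<partial>lborel)" by simp
qed


section \<open>Density of continuous functions and Parseval for compact support\<close>

lemma L2_fun_compact_integrable:
  assumes h: "h \<in> L2_fun lborel" and z: "\<And>x. x \<notin> cball 0 T \<Longrightarrow> h x = 0"
  shows "integrable lborel (h :: 'a::euclidean_space \<Rightarrow> complex)"
proof -
  note [measurable] = L2_fun_measurable[OF h]
  have "integrable lborel (\<lambda>x. indicator (cball 0 T) x + (cmod (h x))\<^sup>2)"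
    using L2_fun_integrable[OF h] emeasure_bounded_finite[of "cball (0::'a) T"] by (intro Bochner_Integration.integrable_add) auto
  moreover have "cmod (h x) \<le> \<bar>indicator (cball 0 T) x + (cmod (h x))\<^sup>2\<bar>" for x
  proof (cases "x \<in> cball 0 T")
    case True
    have "cmod (h x) \<le> 1 + (cmod (h x))\<^sup>2"
      using sum_squares_bound[of "cmod (h x)" 1] norm_ge_zero[of "h x"] by (simp only: power_one mult_1_right)
    with True show ?thesis by simp
  qed (use z in simp)
  ultimately show ?thesis by (elim Bochner_Integration.integrable_bound) auto
qed

lemma L2_fnorm_tendsto_0:
  assumes f: "\<And>n. f n \<in> borel_measurable M" and w: "integrable M w"
    and bd: "\<And>n. AE x in M. (cmod (f n x))\<^sup>2 \<le> w x" and lim: "AE x in M. (\<lambda>n. f n x) \<longlonglongrightarrow> 0"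
  shows "(\<lambda>n. L2_fnorm M (f n)) \<longlonglongrightarrow> 0"
proof -
  note [measurable] = f
  have "(\<lambda>n. \<integral>x. (cmod (f n x))\<^sup>2 \<partial>M) \<longlonglongrightarrow> (\<integral>x. 0 \<partial>M)"
  proof (rule integral_dominated_convergence)
    show "AE x in M. (\<lambda>n. (cmod (f n x))\<^sup>2) \<longlonglongrightarrow> 0"
      using lim
    proof eventually_elim
      case (elim x)
      then show ?case using tendsto_power[OF tendsto_norm[OF elim], of 2] by simp
    qed
  qed (use w bd in auto)
  then show ?thesis
    unfolding L2_fnorm_def using tendsto_real_sqrt by fastforce
qed

lemma L2_approx_bounded:
  assumes h: "h \<in> L2_fun M" and d: "\<delta> > 0"
  obtains K where "K > 0" "(\<lambda>x. if cmod (h x) \<le> K then h x else 0) \<in> L2_fun M"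
    "L2_fnorm M (\<lambda>x. h x - (if cmod (h x) \<le> K then h x else 0)) < \<delta>"
proof -
  note [measurable] = L2_fun_measurable[OF h]
  define t where "t n x = (if cmod (h x) \<le> real (Suc n) then h x else 0)" for n x
  have [measurable]: "t n \<in> borel_measurable M" for n unfolding t_def by measurable
  have "(\<lambda>n. L2_fnorm M (\<lambda>x. h x - t n x)) \<longlonglongrightarrow> 0"
  proof (rule L2_fnorm_tendsto_0[OF _ L2_fun_integrable[OF h]])
    have "(\<lambda>n. h x - t n x) \<longlonglongrightarrow> 0" for x
    proof (rule tendsto_eventually)
      obtain N where "cmod (h x) \<le> real N" using real_arch_simple by blast
      then show "\<forall>\<^sub>F n in sequentially. h x - t n x = 0"
        unfolding eventually_sequentially t_def by (intro exI[of _ N]) auto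
    qed
    then show "AE x in M. (\<lambda>n. h x - t n x) \<longlonglongrightarrow> 0" by simp
  qed (auto simp: t_def)
  then have "\<forall>\<^sub>F n in sequentially. L2_fnorm M (\<lambda>x. h x - t n x) < \<delta>"
    by (rule order_tendstoD(2)) (use d in simp)
  then obtain n where n: "L2_fnorm M (\<lambda>x. h x - t n x) < \<delta>"
    using eventually_happens'[OF sequentially_bot] by blast
  have "integrable M (\<lambda>x. (cmod (t n x))\<^sup>2)"
    by (rule Bochner_Integration.integrable_bound[OF L2_fun_integrable[OF h]]) (auto simp: t_def)
  then have "t n \<in> L2_fun M" by (simp add: L2_fun_def)
  with n show ?thesis by (intro that[of "real (Suc n)"]) (auto simp: t_def[abs_def])
qed

text \<open>Almost everywhere approximation by continuous functions becomes L^2 approximation once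
  the approximants share a bound and a compact support. Hence \<open>h\<close> is first cut off in
  height, and the approximants are then clamped and localised.\<close>

lemma L2_approx_continuous:
  fixes h :: "'a::euclidean_space \<Rightarrow> complex"
  assumes h: "h \<in> L2_fun lborel" and z: "\<And>x. x \<notin> cball 0 T \<Longrightarrow> h x = 0" and d: "\<delta> > 0"
  obtains c K where "c \<in> L2_fun lborel" "continuous_on UNIV c" "\<And>x. cmod (c x) \<le> K"
    "\<And>x. x \<notin> cball 0 (T + 1) \<Longrightarrow> c x = 0" "L2_fnorm lborel (\<lambda>x. h x - c x) < \<delta>"
proof -
  obtain K where K: "K > 0" and hK: "(\<lambda>x. if cmod (h x) \<le> K then h x else 0) \<in> L2_fun lborel"
    and hd: "L2_fnorm lborel (\<lambda>x. h x - (if cmod (h x) \<le> K then h x else 0)) < \<delta> / 2"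
    using L2_approx_bounded[OF h, of "\<delta> / 2"] d by auto
  define k where "k x = (if cmod (h x) \<le> K then h x else 0)" for x
  have k: "k \<in> L2_fun lborel" using hK by (simp add: k_def[abs_def])
  have [measurable]: "k \<in> borel_measurable borel" using L2_fun_measurable[OF k] by simp
  have kK: "cmod (k x) \<le> K" for x using K by (simp add: k_def)
  have kz: "k x = 0" if "x \<notin> cball 0 T" for x using z[OF that] by (simp add: k_def)
  \<comment> \<open>Gives continuous functions converging to \<open>k\<close> off a negligible set,
    but with no control of their size or support.\<close>
  have "k measurable_on UNIV"
    by (rule lebesgue_measurable_imp_measurable_on) (auto intro: measurable_completion)
  then obtain N g where N: "negligible N" and g: "\<And>n. continuous_on UNIV (g n)"
    and lim: "\<And>x. x \<notin> N \<Longrightarrow> (\<lambda>n. g n x) \<longlonglongrightarrow> k x"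
    unfolding measurable_on_def by auto
  \<comment> \<open>\<open>\<theta>\<close> is a cutoff equal to 1 on \<open>cball 0 T\<close> and
    vanishing outside \<open>cball 0 (T + 1)\<close>; \<open>cl\<close> retracts the complex plane
    onto the disc of radius \<open>K\<close>. Neither alters the limit \<open>k\<close>, which
    already obeys both constraints.\<close>
  define \<theta> where "\<theta> x = max 0 (min 1 (T + 1 - norm x))" for x :: 'a
  define cl where "cl w = w / complex_of_real (max 1 (cmod w / K))" for w
  define c where "c n x = \<theta> x *\<^sub>R cl (g n x)" for n x
  have clK: "cmod (cl w) \<le> K" for w
    using K by (auto simp: cl_def norm_divide field_simps max_def)
  have cl_cont: "continuous_on UNIV cl"
    unfolding cl_def[abs_def] using K by (intro continuous_intros) (auto simp: max_def)
  have cl_id: "cl w = w" if "cmod w \<le> K" for w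
    using that K by (simp add: cl_def max_def field_simps)
  have c_cont: "continuous_on UNIV (c n)" for n
    unfolding c_def \<theta>_def by (intro continuous_intros continuous_on_compose2[OF cl_cont g]) auto
  have \<theta>01: "0 \<le> \<theta> x" "\<theta> x \<le> 1" for x by (auto simp: \<theta>_def)
  have cK: "cmod (c n x) \<le> K" for n x
    using mult_mono[OF \<theta>01(2)[of x] clK[of "g n x"]] \<theta>01(1)[of x] by (simp add: c_def)
  have cz: "c n x = 0" if "x \<notin> cball 0 (T + 1)" for n x
    using that by (simp add: c_def \<theta>_def)
  have [measurable]: "c n \<in> borel_measurable borel" for n
    using c_cont by (rule borel_measurable_continuous_onI)
  have ball: "integrable lborel (\<lambda>x. C * indicator (cball 0 (T + 1)) (x :: 'a))" for C :: real
    using emeasure_bounded_finite[of "cball (0::'a) (T + 1)"] by auto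
  have "integrable lborel (\<lambda>x. (cmod (c n x))\<^sup>2)" for n
  proof (rule Bochner_Integration.integrable_bound[OF ball[of "K\<^sup>2"]])
    show "AE x in lborel. norm ((cmod (c n x))\<^sup>2) \<le> norm (K\<^sup>2 * indicator (cball 0 (T + 1)) x)"
      using cz[of _ n] cK[of n] by (auto simp: indicator_def power_mono split: if_splits)
  qed simp
  then have c: "c n \<in> L2_fun lborel" for n by (simp add: L2_fun_def)
  have "(\<lambda>n. L2_fnorm lborel (\<lambda>x. k x - c n x)) \<longlonglongrightarrow> 0"
  proof (rule L2_fnorm_tendsto_0[OF _ ball[of "(2 * K)\<^sup>2"]])
    have "AE x in lebesgue. x \<notin> N"
      using N by (intro AE_not_in) (simp add: negligible_iff_null_sets)
    then have "AE x in lborel. x \<notin> N"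
      by (simp only: AE_completion_iff)
    then show "AE x in lborel. (\<lambda>n. k x - c n x) \<longlonglongrightarrow> 0"
    proof eventually_elim
      case (elim x)
      have "(\<lambda>n. cl (g n x)) \<longlonglongrightarrow> cl (k x)"
        by (rule continuous_on_tendsto_compose[OF cl_cont lim[OF elim]]) auto
      then have "(\<lambda>n. c n x) \<longlonglongrightarrow> \<theta> x *\<^sub>R k x"
        unfolding c_def by (intro tendsto_intros) (simp add: cl_id kK)
      moreover have "\<theta> x *\<^sub>R k x = k x"
        using kz[of x] by (cases "x \<in> cball 0 T") (auto simp: \<theta>_def)
      ultimately show ?case using tendsto_diff[OF tendsto_const[of "k x"], of "\<lambda>n. c n x" "k x"] by simp
    qed
    show "AE x in lborel. (cmod (k x - c n x))\<^sup>2 \<le> (2 * K)\<^sup>2 * indicator (cball 0 (T + 1)) x" for n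
    proof (intro always_eventually allI)
      fix x
      have "cmod (k x - c n x) \<le> 2 * K"
        using norm_triangle_ineq4[of "k x" "c n x"] kK[of x] cK[of n x] by linarith
      then show "(cmod (k x - c n x))\<^sup>2 \<le> (2 * K)\<^sup>2 * indicator (cball 0 (T + 1)) x"
        using power_mono[of "cmod (k x - c n x)" "2 * K" 2] kz[of x] cz[of x n]
        by (cases "x \<in> cball 0 (T + 1)") auto
    qed
  qed measurable
  then have "\<forall>\<^sub>F n in sequentially. L2_fnorm lborel (\<lambda>x. k x - c n x) < \<delta> / 2"
    by (rule order_tendstoD(2)) (use d in simp)
  then obtain n where n: "L2_fnorm lborel (\<lambda>x. k x - c n x) < \<delta> / 2"
    using eventually_happens'[OF sequentially_bot] by blast
  have "L2_fnorm lborel (\<lambda>x. h x - c n x) \<le> L2_fnorm lborel (\<lambda>x. h x - k x) + L2_fnorm lborel (\<lambda>x. k x - c n x)"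
    using L2_fnorm_triangle[OF L2_fun_diff[OF h k] L2_fun_diff[OF k c[of n]]] by simp
  also have "\<dots> < \<delta>" using n hd by (simp add: k_def)
  finally show ?thesis using that[of "c n" K] c c_cont cK cz by blast
qed

text \<open>Both sides depend continuously on \<open>h\<close> in the L^2 norm, the frequency side
  thanks to \<open>L2_fnorm_fourier_le\<close>, so the continuous case extends by density. This
  admits functions that jump at the boundary of their support.\<close>

lemma Parseval_compact_support:
  fixes f h :: "'a::euclidean_space \<Rightarrow> complex"
  assumes f: "integrable lborel f" "f \<in> L2_fun lborel"
    and h: "h \<in> L2_fun lborel" and z: "\<And>x. x \<notin> cball 0 T \<Longrightarrow> h x = 0"
  shows "(\<integral>\<xi>. fourier f \<xi> * cnj (fourier h \<xi>) \<partial>lborel) = (\<integral>x. f x * cnj (h x) \<partial>lborel)" (is "?A = ?B")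
proof -
  have h1: "integrable lborel h" by (rule L2_fun_compact_integrable[OF h z])
  have bound: "cmod (?A - ?B) \<le> 2 * L2_fnorm lborel f * \<delta>" if d: "\<delta> > 0" for \<delta>
  proof -
    obtain c K where c: "c \<in> L2_fun lborel" "continuous_on UNIV c" "\<And>x. cmod (c x) \<le> K"
      "\<And>x. x \<notin> cball 0 (T + 1) \<Longrightarrow> c x = 0" and cd: "L2_fnorm lborel (\<lambda>x. h x - c x) < \<delta>"
      by (rule L2_approx_continuous[OF h z d]) auto
    have c1: "integrable lborel c" by (rule L2_fun_compact_integrable[OF c(1,4)])
    let ?d = "\<lambda>x. h x - c x"
    have d1: "integrable lborel ?d" using h1 c1 by simp
    have d2: "?d \<in> L2_fun lborel" by (rule L2_fun_diff[OF h c(1)])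
    have "(\<integral>\<xi>. fourier f \<xi> * cnj (fourier ?d \<xi>) \<partial>lborel) = ?A - (\<integral>\<xi>. fourier f \<xi> * cnj (fourier c \<xi>) \<partial>lborel)"
      unfolding fourier_diff[OF h1 c1] complex_cnj_diff right_diff_distrib
      by (intro Bochner_Integration.integral_diff L2_fun_mult_integrable fourier_L2_fun f h h1 c c1)
    also have "(\<integral>\<xi>. fourier f \<xi> * cnj (fourier c \<xi>) \<partial>lborel) = (\<integral>x. f x * cnj (c x) \<partial>lborel)"
      by (rule Parseval_continuous[OF f c1 c(1-3)])
    finally have A: "?A = (\<integral>\<xi>. fourier f \<xi> * cnj (fourier ?d \<xi>) \<partial>lborel) + (\<integral>x. f x * cnj (c x) \<partial>lborel)"
      by simp
    have B: "(\<integral>x. f x * cnj (?d x) \<partial>lborel) = ?B - (\<integral>x. f x * cnj (c x) \<partial>lborel)"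
      unfolding complex_cnj_diff right_diff_distrib
      by (intro Bochner_Integration.integral_diff L2_fun_mult_integrable f h c)
    have "cmod (?A - ?B) = cmod ((\<integral>\<xi>. fourier f \<xi> * cnj (fourier ?d \<xi>) \<partial>lborel) - (\<integral>x. f x * cnj (?d x) \<partial>lborel))"
      unfolding A B by (simp add: algebra_simps)
    also have "\<dots> \<le> L2_fnorm lborel (fourier f) * L2_fnorm lborel (fourier ?d) + L2_fnorm lborel f * L2_fnorm lborel ?d"
      by (intro order_trans[OF norm_triangle_ineq4] add_mono L2_Cauchy_Schwarz fourier_L2_fun f d1 d2)
    also have "\<dots> \<le> L2_fnorm lborel f * \<delta> + L2_fnorm lborel f * \<delta>"
      using cd L2_fnorm_fourier_le[OF f] L2_fnorm_fourier_le[OF d1 d2]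
      by (intro add_mono mult_mono) (auto simp: L2_fnorm_nonneg)
    finally show ?thesis by (simp add: mult_ac)
  qed
  have "cmod (?A - ?B) \<le> 0"
  proof (rule field_le_epsilon)
    fix e :: real assume e: "e > 0"
    \<comment> \<open>The summand 1 keeps the divisor positive when \<open>f\<close> has norm
      0.\<close>
    let ?m = "2 * L2_fnorm lborel f + 1"
    have m: "?m > 0" using L2_fnorm_nonneg[of lborel f] by linarith
    have "2 * L2_fnorm lborel f * (e / ?m) \<le> e"
      using m e by (simp add: field_simps)
    with bound[of "e / ?m"] m e show "cmod (?A - ?B) \<le> 0 + e" by fastforce
  qed
  then show ?thesis by simp
qed

section \<open>Parseval for the L^2 Fourier transform\<close>

lemma fourier_trunc_eq: "fourier_trunc k f = fourier (restrict0 (cball 0 (real k)) f)"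
  unfolding fourier_trunc_def fourier_def set_lebesgue_integral_def fun_eq_iff
  by (auto simp: restrict0_def indicator_def intro!: Bochner_Integration.integral_cong)

lemma restrict0_L2_fun:
  assumes f: "f \<in> L2_fun M" and [measurable]: "A \<in> sets M"
  shows "restrict0 A f \<in> L2_fun M"
proof -
  note [measurable] = L2_fun_measurable[OF f]
  have [measurable]: "restrict0 A f \<in> borel_measurable M" unfolding restrict0_def by measurable
  have "integrable M (\<lambda>x. (cmod (restrict0 A f x))\<^sup>2)"
    by (rule Bochner_Integration.integrable_bound[OF L2_fun_integrable[OF f]]) (auto simp: restrict0_def)
  then show ?thesis by (simp add: L2_fun_def)
qed

text \<open>In space the pairing sees only the ball carrying \<open>h\<close>, so truncating
  \<open>U\<close> to a larger ball changes nothing; in frequency the truncated transforms tend to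
  \<open>g\<close> in L^2. The identity for truncations therefore passes to the limit although
  \<open>U\<close> need not be integrable.\<close>

lemma has_fourier_Parseval:
  fixes U g h :: "real ^ 'n \<Rightarrow> complex"
  assumes Ug: "has_fourier U g" and h: "h \<in> L2_fun lborel" and z: "\<And>x. x \<notin> cball 0 R \<Longrightarrow> h x = 0"
  shows "(\<integral>x. U x * cnj (h x) \<partial>lborel) = (\<integral>\<xi>. g \<xi> * cnj (fourier h \<xi>) \<partial>lborel)" (is "?A = ?B")
proof -
  have U: "U \<in> L2_fun lborel" and g: "g \<in> L2_fun lborel"
    and lim: "(\<lambda>k. \<integral>\<^sup>+ \<xi>. ennreal ((cmod (fourier_trunc k U \<xi> - g \<xi>))\<^sup>2) \<partial>lborel) \<longlonglongrightarrow> 0"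
    using Ug by (auto simp: has_fourier_def)
  have h1: "integrable lborel h" by (rule L2_fun_compact_integrable[OF h z])
  note hF = fourier_L2_fun[OF h1 h]
  let ?U = "\<lambda>k. restrict0 (cball 0 (real k)) U"
  have U2: "?U k \<in> L2_fun lborel" for k by (rule restrict0_L2_fun[OF U]) auto
  have U1: "integrable lborel (?U k)" for k
    by (rule L2_fun_compact_integrable[OF U2]) (auto simp: restrict0_def)
  let ?e = "\<lambda>k. L2_fnorm lborel (\<lambda>\<xi>. fourier (?U k) \<xi> - g \<xi>)"
  have dL: "(\<lambda>\<xi>. fourier (?U k) \<xi> - g \<xi>) \<in> L2_fun lborel" for k
    by (intro L2_fun_diff fourier_L2_fun U1 U2 g)
  have "(\<integral>\<^sup>+ \<xi>. ennreal ((cmod (fourier_trunc k U \<xi> - g \<xi>))\<^sup>2) \<partial>lborel) = ennreal ((?e k)\<^sup>2)" for k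
    using nn_integral_eq_integral[OF L2_fun_integrable[OF dL[of k]]]
    by (simp add: fourier_trunc_eq L2_fnorm_square)
  with lim have "(\<lambda>k. ennreal ((?e k)\<^sup>2)) \<longlonglongrightarrow> ennreal 0" by simp
  then have "(\<lambda>k. (?e k)\<^sup>2) \<longlonglongrightarrow> 0" by (subst (asm) tendsto_ennreal_iff) auto
  then have "(\<lambda>k. sqrt ((?e k)\<^sup>2)) \<longlonglongrightarrow> sqrt 0" by (rule tendsto_real_sqrt)
  then have "?e \<longlonglongrightarrow> 0" by (simp add: L2_fnorm_nonneg)
  then have "(\<lambda>k. ?e k * L2_fnorm lborel (fourier h)) \<longlonglongrightarrow> 0" by (rule tendsto_mult_left_zero)
  moreover have "\<forall>\<^sub>F k in sequentially. cmod (?A - ?B) \<le> ?e k * L2_fnorm lborel (fourier h)"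
  proof -
    obtain m :: nat where m: "R \<le> real m" using real_arch_simple by blast
    have "cmod (?A - ?B) \<le> ?e k * L2_fnorm lborel (fourier h)" if "k \<ge> m" for k
    proof -
      have "?A = (\<integral>x. ?U k x * cnj (h x) \<partial>lborel)"
        using z m that by (intro Bochner_Integration.integral_cong) (force simp: restrict0_def)+
      also have "\<dots> = (\<integral>\<xi>. fourier (?U k) \<xi> * cnj (fourier h \<xi>) \<partial>lborel)"
        by (rule Parseval_compact_support[OF U1 U2 h z, symmetric])
      finally have "?A - ?B = (\<integral>\<xi>. (fourier (?U k) \<xi> - g \<xi>) * cnj (fourier h \<xi>) \<partial>lborel)"
        unfolding left_diff_distrib
        by (simp add: Bochner_Integration.integral_diff[OF L2_fun_mult_integrable L2_fun_mult_integrable]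
            fourier_L2_fun U1 U2 g hF)
      then show ?thesis using L2_Cauchy_Schwarz[OF dL hF] by simp
    qed
    then show ?thesis using eventually_sequentially by blast
  qed
  ultimately have "cmod (?A - ?B) \<le> 0"
    by (intro tendsto_le[OF _ _ tendsto_const]) auto
  then show ?thesis by simp
qed

text \<open>Links two choices: \<open>Hs_space\<close> provides some transform with finite weighted
  norm, whereas \<open>Hs_space_norm\<close> evaluates the one picked by
  \<open>SOME\<close>.\<close>

lemma has_fourier_unique:
  assumes f: "has_fourier U f" and g: "has_fourier U g"
  shows "AE \<xi> in lborel. f \<xi> = g \<xi>"
proof -
  have U: "U \<in> L2_fun lborel" and fg: "f \<in> L2_fun lborel" "g \<in> L2_fun lborel"
    using f g by (auto simp: has_fourier_def)
  note [measurable] = L2_fun_measurable[OF U] L2_fun_measurable[OF fg(1)] L2_fun_measurable[OF fg(2)]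
  have [measurable]: "fourier_trunc k U \<in> borel_measurable borel" for k
    unfolding fourier_trunc_eq using L2_fun_measurable[OF restrict0_L2_fun[OF U]]
    by (intro fourier_measurable) auto
  let ?I = "\<lambda>h. \<integral>\<^sup>+ \<xi>. ennreal ((cmod (h \<xi>))\<^sup>2) \<partial>lborel"
  have "?I (\<lambda>\<xi>. f \<xi> - g \<xi>) \<le> 2 * ?I (\<lambda>\<xi>. fourier_trunc k U \<xi> - f \<xi>) + 2 * ?I (\<lambda>\<xi>. fourier_trunc k U \<xi> - g \<xi>)" for k
  proof -
    have "(cmod (f \<xi> - g \<xi>))\<^sup>2 \<le> 2 * (cmod (fourier_trunc k U \<xi> - f \<xi>))\<^sup>2 + 2 * (cmod (fourier_trunc k U \<xi> - g \<xi>))\<^sup>2" for \<xi>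
      using norm_add_sq_le[of "fourier_trunc k U \<xi> - g \<xi>" "- (fourier_trunc k U \<xi> - f \<xi>)"]
      by (simp add: norm_minus_commute)
    then have "?I (\<lambda>\<xi>. f \<xi> - g \<xi>) \<le> (\<integral>\<^sup>+ \<xi>. 2 * ennreal ((cmod (fourier_trunc k U \<xi> - f \<xi>))\<^sup>2) + 2 * ennreal ((cmod (fourier_trunc k U \<xi> - g \<xi>))\<^sup>2) \<partial>lborel)"
      by (intro nn_integral_mono) (simp add: ennreal_mult[symmetric] ennreal_plus[symmetric] ennreal_leI del: ennreal_plus flip: ennreal_numeral)
    also have "\<dots> = 2 * ?I (\<lambda>\<xi>. fourier_trunc k U \<xi> - f \<xi>) + 2 * ?I (\<lambda>\<xi>. fourier_trunc k U \<xi> - g \<xi>)"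
      by (simp add: nn_integral_add nn_integral_cmult)
    finally show ?thesis .
  qed
  moreover have "(\<lambda>k. 2 * ?I (\<lambda>\<xi>. fourier_trunc k U \<xi> - f \<xi>) + 2 * ?I (\<lambda>\<xi>. fourier_trunc k U \<xi> - g \<xi>)) \<longlonglongrightarrow> 2 * 0 + 2 * 0"
    using f g unfolding has_fourier_def
    by (intro tendsto_add ennreal_tendsto_cmult) auto
  ultimately have "?I (\<lambda>\<xi>. f \<xi> - g \<xi>) \<le> 2 * 0 + 2 * 0"
    by (intro tendsto_le[OF sequentially_bot _ tendsto_const[of "?I (\<lambda>\<xi>. f \<xi> - g \<xi>)"]]) auto
  then have "?I (\<lambda>\<xi>. f \<xi> - g \<xi>) = 0" by simp
  then show ?thesis
    by (subst (asm) nn_integral_0_iff_AE) auto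
qed

section \<open>Polynomials on the ball\<close>

text \<open>A single term of the exponential series. It serves both as the Stirling-type bound m^m /
  m! \<le> e^m and to absorb a fixed power of m into e^m.\<close>

lemma power_div_fact_le_exp: "x ^ k / fact k \<le> exp x" if "x \<ge> 0" for x :: real
proof -
  have "(\<Sum>i\<in>{k}. inverse (fact i) * x ^ i) \<le> (\<Sum>i. inverse (fact i) * x ^ i)"
    using that summable_exp[of x] by (intro sum_le_suminf) auto
  then show ?thesis by (simp add: exp_def divide_inverse mult.commute)
qed

definition monomial :: "('n::finite \<Rightarrow> nat) \<Rightarrow> real ^ 'n \<Rightarrow> complex" where
  "monomial \<alpha> x = complex_of_real (\<Prod>i\<in>UNIV. (x $ i) ^ \<alpha> i)"

text \<open>The simplex of multi-indices sits inside the box of side n + 1. This crude count has the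
  right order n^d, and the constant in the rate comes from it.\<close>

lemma
  shows finite_multi_indices: "finite {\<alpha> :: 'n::finite \<Rightarrow> nat. (\<Sum>i\<in>UNIV. \<alpha> i) \<le> n}"
    and card_multi_indices_le: "card {\<alpha> :: 'n \<Rightarrow> nat. (\<Sum>i\<in>UNIV. \<alpha> i) \<le> n} \<le> Suc n ^ CARD('n)"
proof -
  have sub: "{\<alpha> :: 'n \<Rightarrow> nat. (\<Sum>i\<in>UNIV. \<alpha> i) \<le> n} \<subseteq> PiE UNIV (\<lambda>_. {..n})"
  proof
    fix \<alpha> :: "'n \<Rightarrow> nat" assume "\<alpha> \<in> {\<alpha>. (\<Sum>i\<in>UNIV. \<alpha> i) \<le> n}"
    moreover have "\<alpha> i \<le> (\<Sum>i\<in>UNIV. \<alpha> i)" for i by (rule member_le_sum) auto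
    ultimately show "\<alpha> \<in> PiE UNIV (\<lambda>_. {..n})" by (auto intro: order_trans)
  qed
  have fin: "finite (PiE (UNIV :: 'n set) (\<lambda>_. {..n}))" by (intro finite_PiE) auto
  show "finite {\<alpha> :: 'n \<Rightarrow> nat. (\<Sum>i\<in>UNIV. \<alpha> i) \<le> n}" by (rule finite_subset[OF sub fin])
  show "card {\<alpha> :: 'n \<Rightarrow> nat. (\<Sum>i\<in>UNIV. \<alpha> i) \<le> n} \<le> Suc n ^ CARD('n)"
    using card_mono[OF fin sub] by (simp add: card_PiE)
qed

lemma poly_funs_eq:
  "poly_funs n = {f. \<exists>c. f = (\<lambda>x. \<Sum>\<alpha> | (\<Sum>i\<in>UNIV. \<alpha> i) \<le> n. c \<alpha> * monomial \<alpha> x)}"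
  by (simp add: poly_funs_def monomial_def)

lemma subspace_poly_funs: "cfun.subspace (poly_funs n)"
proof (rule cfun.subspaceI)
  show "0 \<in> poly_funs n"
    unfolding poly_funs_eq by (auto intro!: exI[of _ "\<lambda>_. 0"])
next
  fix f g :: "real ^ 'a \<Rightarrow> complex" assume "f \<in> poly_funs n" "g \<in> poly_funs n"
  then obtain c d where "f = (\<lambda>x. \<Sum>\<alpha> | (\<Sum>i\<in>UNIV. \<alpha> i) \<le> n. c \<alpha> * monomial \<alpha> x)"
    "g = (\<lambda>x. \<Sum>\<alpha> | (\<Sum>i\<in>UNIV. \<alpha> i) \<le> n. d \<alpha> * monomial \<alpha> x)"
    unfolding poly_funs_eq by blast
  then show "f + g \<in> poly_funs n"
    unfolding poly_funs_eq
    by (auto intro!: exI[of _ "\<lambda>\<alpha>. c \<alpha> + d \<alpha>"] simp: fun_eq_iff distrib_right sum.distrib)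
next
  fix a and f :: "real ^ 'a \<Rightarrow> complex" assume "f \<in> poly_funs n"
  then obtain c where "f = (\<lambda>x. \<Sum>\<alpha> | (\<Sum>i\<in>UNIV. \<alpha> i) \<le> n. c \<alpha> * monomial \<alpha> x)"
    unfolding poly_funs_eq by blast
  then show "fscale a f \<in> poly_funs n"
    unfolding poly_funs_eq
    by (auto intro!: exI[of _ "\<lambda>\<alpha>. a * c \<alpha>"] simp: fun_eq_iff fscale_def sum_distrib_left mult.assoc)
qed

lemma monomial_in_poly_funs: "(\<Sum>i\<in>UNIV. \<alpha> i) \<le> n \<Longrightarrow> monomial \<alpha> \<in> poly_funs n"
  unfolding poly_funs_eq
  by (auto intro!: exI[of _ "\<lambda>\<beta>. if \<beta> = \<alpha> then 1 else 0"]
      simp: if_distrib[of "\<lambda>x. x * _"] finite_multi_indices cong: if_cong)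

lemma fun_sum_apply: "(\<Sum>i\<in>I. f i) x = (\<Sum>i\<in>I. f i x)" for f :: "'i \<Rightarrow> 'a \<Rightarrow> complex"
  by (induction I rule: infinite_finite_induct) auto

lemma poly_funs_subset_span: "poly_funs n \<subseteq> cfun.span (monomial ` {\<alpha>. (\<Sum>i\<in>UNIV. \<alpha> i) \<le> n})"
proof
  fix f :: "real ^ 'a \<Rightarrow> complex" assume "f \<in> poly_funs n"
  then obtain c where "f = (\<lambda>x. \<Sum>\<alpha> | (\<Sum>i\<in>UNIV. \<alpha> i) \<le> n. c \<alpha> * monomial \<alpha> x)"
    unfolding poly_funs_eq by blast
  then have "f = (\<Sum>\<alpha> | (\<Sum>i\<in>UNIV. \<alpha> i) \<le> n. fscale (c \<alpha>) (monomial \<alpha>))"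
    by (simp add: fun_eq_iff fun_sum_apply fscale_def)
  then show "f \<in> cfun.span (monomial ` {\<alpha>. (\<Sum>i\<in>UNIV. \<alpha> i) \<le> n})"
    by (simp only:) (intro cfun.span_sum cfun.span_scale cfun.span_base imageI)
qed

lemma span_monomials_subset:
  assumes "n \<le> m"
  shows "cfun.span (monomial ` {\<alpha>. (\<Sum>i\<in>UNIV. \<alpha> i) \<le> n}) \<subseteq> poly_funs m"
  by (rule cfun.span_minimal[OF _ subspace_poly_funs])
     (use assms in \<open>auto intro: monomial_in_poly_funs\<close>)

lemma poly_funs_mono: "n \<le> m \<Longrightarrow> poly_funs n \<subseteq> poly_funs m"
  using poly_funs_subset_span span_monomials_subset by blast

lemma poly_funs_mult_coord:
  fixes i :: "'n::finite"
  assumes "f \<in> poly_funs n"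
  shows "(\<lambda>x. complex_of_real (x $ i) * f x) \<in> poly_funs (Suc n)"
proof -
  obtain c where f: "f = (\<lambda>x. \<Sum>\<alpha> | (\<Sum>i\<in>UNIV. \<alpha> i) \<le> n. c \<alpha> * monomial \<alpha> x)"
    using assms unfolding poly_funs_eq by blast
  have mono: "complex_of_real (x $ i) * monomial \<alpha> x = monomial (\<alpha>(i := Suc (\<alpha> i))) x" for \<alpha> x
    by (simp add: monomial_def prod.remove[of UNIV i] flip: of_real_mult)
  have "(\<lambda>x. complex_of_real (x $ i) * f x)
      = (\<Sum>\<alpha> | (\<Sum>i\<in>UNIV. \<alpha> i) \<le> n. fscale (c \<alpha>) (monomial (\<alpha>(i := Suc (\<alpha> i)))))"
    by (simp add: f fun_eq_iff fun_sum_apply fscale_def sum_distrib_left mono[symmetric] mult.left_commute)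
  also have "\<dots> \<in> poly_funs (Suc n)"
    by (intro cfun.subspace_sum cfun.subspace_scale subspace_poly_funs monomial_in_poly_funs)
       (auto simp: sum.remove[of UNIV i])
  finally show ?thesis .
qed

lemma const_in_poly_funs: "(\<lambda>_. 1) \<in> poly_funs n"
  using monomial_in_poly_funs[of "\<lambda>_. 0" n] by (simp add: monomial_def[abs_def])

text \<open>These powers are the terms of the Taylor polynomials of the characters. Each step of the
  induction multiplies by the linear form \<open>x \<bullet> \<xi>\<close>, expanded in
  coordinates.\<close>

lemma inner_power_in_poly_funs: "(\<lambda>x. complex_of_real ((x \<bullet> \<xi>) ^ j)) \<in> poly_funs j" for \<xi> :: "real ^ 'n"
proof (induction j)
  case (Suc j)
  have "(\<lambda>x. complex_of_real ((x \<bullet> \<xi>) ^ Suc j))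
      = (\<Sum>i\<in>UNIV. fscale (complex_of_real (\<xi> $ i)) (\<lambda>x. complex_of_real (x $ i) * complex_of_real ((x \<bullet> \<xi>) ^ j)))"
    by (simp add: fun_eq_iff fun_sum_apply fscale_def inner_vec_def[of _ \<xi>] sum_distrib_right mult_ac)
  also have "\<dots> \<in> poly_funs (Suc j)"
    by (intro cfun.subspace_sum cfun.subspace_scale subspace_poly_funs poly_funs_mult_coord Suc)
  finally show ?case .
qed (use const_in_poly_funs[of 0] in simp)

lemma linear_restrict0: "Vector_Spaces.linear fscale fscale (restrict0 B)"
  by unfold_locales (auto simp: restrict0_def fscale_def fun_eq_iff)

lemma poly_dim_le:
  "poly_dim TYPE('n::finite) R n \<le> Suc n ^ CARD('n)"
proof -
  let ?I = "{\<alpha> :: 'n \<Rightarrow> nat. (\<Sum>i\<in>UNIV. \<alpha> i) \<le> n}"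
  interpret r: Vector_Spaces.linear fscale fscale "restrict0 (cball 0 R) :: (real ^ 'n \<Rightarrow> complex) \<Rightarrow> _"
    by (rule linear_restrict0)
  have "poly_ball R n \<subseteq> cfun.span (restrict0 (cball 0 R) ` monomial ` ?I)"
    unfolding poly_ball_def r.span_image using poly_funs_subset_span by blast
  then have "poly_dim TYPE('n) R n \<le> card (restrict0 (cball 0 R) ` monomial ` ?I)"
    unfolding poly_dim_def by (rule cfun.dim_le_card) (simp add: finite_multi_indices)
  also have "\<dots> \<le> card ?I"
    by (simp add: image_image card_image_le finite_multi_indices)
  also note card_multi_indices_le
  finally show ?thesis .
qed

section \<open>Fourier transforms of functions orthogonal to polynomials\<close>

text \<open>Subtracting the degree n Taylor polynomial of the character leaves the integral against
  \<open>h\<close> unchanged by orthogonality, and on the ball the remainder is at most (R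
  |\<xi>|)^(n+1) / (n+1)!. Orthogonality is stated without conjugation to match the Fourier
  integrand.\<close>

lemma fourier_low_frequency:
  fixes h :: "real ^ 'n \<Rightarrow> complex"
  assumes h: "h \<in> L2_fun lborel" and z: "\<And>x. x \<notin> cball 0 R \<Longrightarrow> h x = 0"
    and orth: "\<And>f. f \<in> poly_funs n \<Longrightarrow> (\<integral>x. f x * h x \<partial>lborel) = 0"
  shows "cmod (fourier h \<xi>) \<le> (2 * pi) powr (- real CARD('n) / 2) *
      ((R * norm \<xi>) ^ Suc n / fact (Suc n) * (\<integral>x. cmod (h x) \<partial>lborel))"
proof -
  have h1: "integrable lborel h" by (rule L2_fun_compact_integrable[OF h z])
  note [measurable] = L2_fun_measurable[OF h]
  define T where "T x = (\<Sum>k\<le>n. (\<i> * complex_of_real (- (x \<bullet> \<xi>))) ^ k / fact k)" for x :: "real ^ 'n"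
  have [measurable]: "T \<in> borel_measurable borel" unfolding T_def by measurable
  have "T = (\<Sum>k\<le>n. fscale ((- \<i>) ^ k / fact k) (\<lambda>x. complex_of_real ((x \<bullet> \<xi>) ^ k)))"
    by (simp add: fun_eq_iff T_def fun_sum_apply fscale_def flip: power_mult_distrib)
  also have "\<dots> \<in> poly_funs n"
    by (intro cfun.subspace_sum cfun.subspace_scale subspace_poly_funs)
       (use inner_power_in_poly_funs poly_funs_mono in blast)
  finally have T0: "(\<integral>x. T x * h x \<partial>lborel) = 0" by (rule orth)
  let ?b = "(R * norm \<xi>) ^ Suc n / fact (Suc n)"
  have bd: "cmod ((cis (- (x \<bullet> \<xi>)) - T x) * h x) \<le> ?b * cmod (h x)" for x
  proof (cases "x \<in> cball 0 R")
    case True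
    have "cmod (cis (- (x \<bullet> \<xi>)) - T x) \<le> \<bar>- (x \<bullet> \<xi>)\<bar> ^ Suc n / fact (Suc n)"
      unfolding T_def cis_conv_exp by (rule iexp_approx1)
    also have "\<dots> \<le> ?b"
      using order_trans[OF Cauchy_Schwarz_ineq2[of x \<xi>] mult_right_mono[of "norm x" R "norm \<xi>"]] True
      by (intro divide_right_mono power_mono) auto
    finally show ?thesis unfolding norm_mult by (rule mult_right_mono) simp
  qed (use z in simp)
  have bi: "integrable lborel (\<lambda>x. ?b * cmod (h x))" using h1 by simp
  have di: "integrable lborel (\<lambda>x. (cis (- (x \<bullet> \<xi>)) - T x) * h x)"
  proof (rule Bochner_Integration.integrable_bound[OF bi])
    show "AE x in lborel. cmod ((cis (- (x \<bullet> \<xi>)) - T x) * h x) \<le> norm (?b * cmod (h x))"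
      unfolding real_norm_def by (intro always_eventually allI order_trans[OF bd abs_ge_self])
  qed measurable
  have ti: "integrable lborel (\<lambda>x. T x * h x)"
    using Bochner_Integration.integrable_diff[OF cis_mult_integrable[OF h1, of \<xi>] di] by (simp add: algebra_simps)
  have "(\<integral>x. cis (- (x \<bullet> \<xi>)) * h x \<partial>lborel) = (\<integral>x. (cis (- (x \<bullet> \<xi>)) - T x) * h x \<partial>lborel)"
    using Bochner_Integration.integral_diff[OF cis_mult_integrable[OF h1, of \<xi>] ti] T0 by (simp add: algebra_simps)
  also have "cmod \<dots> \<le> (\<integral>x. ?b * cmod (h x) \<partial>lborel)"
    by (rule Bochner_Integration.integral_norm_bound_integral[OF di bi bd])
  finally have "cmod (\<integral>x. cis (- (x \<bullet> \<xi>)) * h x \<partial>lborel) \<le> ?b * (\<integral>x. cmod (h x) \<partial>lborel)" by simp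
  from mult_left_mono[OF this, of "(2 * pi) powr (- real CARD('n) / 2)"] show ?thesis
    by (simp add: fourier_def norm_mult)
qed

lemma integral_cmod_le_L2_fnorm:
  fixes h :: "'a::euclidean_space \<Rightarrow> complex"
  assumes h: "h \<in> L2_fun lborel" and z: "\<And>x. x \<notin> cball 0 R \<Longrightarrow> h x = 0"
  shows "(\<integral>x. cmod (h x) \<partial>lborel) \<le> sqrt (measure lborel (cball 0 R :: 'a set)) * L2_fnorm lborel h"
proof -
  let ?i = "\<lambda>x::'a. complex_of_real (indicator (cball 0 R) x)"
  have i2: "(cmod (?i x))\<^sup>2 = indicator (cball 0 R) x" for x by (simp add: indicator_def)
  have "integrable lborel (indicator (cball (0::'a) R) :: 'a \<Rightarrow> real)"
    using emeasure_bounded_finite[of "cball (0::'a) R"] by auto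
  then have "integrable lborel (\<lambda>x. (cmod (?i x))\<^sup>2)" unfolding i2 .
  moreover have "?i \<in> borel_measurable borel"
  proof -
    have [measurable]: "cball (0::'a) R \<in> sets borel" by simp
    show ?thesis by measurable
  qed
  ultimately have i: "?i \<in> L2_fun lborel" by (simp add: L2_fun_def)
  have "(\<integral>x. cmod (h x) \<partial>lborel) = (\<integral>x. cmod (?i x) * cmod (h x) \<partial>lborel)"
    using z by (intro Bochner_Integration.integral_cong) (auto simp: indicator_def)
  also have "\<dots> \<le> L2_fnorm lborel ?i * L2_fnorm lborel h"
    by (rule L2_abs_Cauchy_Schwarz[OF i h])
  also have "L2_fnorm lborel ?i = sqrt (measure lborel (cball 0 R :: 'a set))"
    unfolding L2_fnorm_def i2 by simp
  finally show ?thesis .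
qed


text \<open>
  Below the frequency \<open>m / (e\<^sup>2 R)\<close> the transform of a function orthogonal to the polynomials of degree
  less than \<open>m\<close> is of size \<open>e\<^sup>-\<^sup>m\<close>, above it the Sobolev weight gains \<open>m\<^sup>-\<^sup>s\<close>.
\<close>

lemma fourier_weighted_estimate:
  fixes R s :: real
  assumes R: "R > 0" and s: "s > 0"
  obtains K where "K > 0"
    "\<And>n (h :: real ^ 'n \<Rightarrow> complex). h \<in> L2_fun lborel \<Longrightarrow> (\<And>x. x \<notin> cball 0 R \<Longrightarrow> h x = 0) \<Longrightarrow>
      (\<And>f. f \<in> poly_funs n \<Longrightarrow> (\<integral>x. f x * h x \<partial>lborel) = 0) \<Longrightarrow>
      (\<lambda>\<xi>. complex_of_real ((1 + (norm \<xi>)\<^sup>2) powr (- s / 2)) * fourier h \<xi>) \<in> L2_fun lborel \<and>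
      L2_fnorm lborel (\<lambda>\<xi>. complex_of_real ((1 + (norm \<xi>)\<^sup>2) powr (- s / 2)) * fourier h \<xi>)
        \<le> K * real (Suc n) powr (- s) * L2_fnorm lborel h"
proof -
  define d where "d = CARD('n)"
  \<comment> \<open>Chosen so that R l = e^(-2): one factor e^(-m) is spent on m^m / m! \<le> e^m,
    the other remains as decay.\<close>
  define l where "l = 1 / (exp 2 * R)"
  have l: "l > 0" "R * l = exp (-2)" using R by (auto simp: l_def exp_minus field_simps)
  define c where "c = (2 * pi) powr (- real CARD('n) / 2) * sqrt (measure lborel (cball 0 R :: (real ^ 'n) set))"
  have c: "c \<ge> 0" by (simp add: c_def)
  \<comment> \<open>An integer at least d + 2s, so that m^(d + 2s) \<le> m^j \<le> j! e^m.\<close>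
  define j where "j = d + nat \<lceil>2 * s\<rceil>"
  define V where "V = unit_ball_vol d"
  have V: "V \<ge> 0" by (simp add: V_def unit_ball_vol_nonneg)
  \<comment> \<open>The first summand comes from the low frequencies, the second from the high ones;
    the second alone already makes the sum positive.\<close>
  define K2 where "K2 = c\<^sup>2 * (V * l ^ d) * fact j + l powr (- 2 * s)"
  have K2: "K2 > 0" unfolding K2_def using l c V by (intro add_nonneg_pos) auto
  show ?thesis
  proof (rule that[of "sqrt K2"])
    show "sqrt K2 > 0" using K2 by simp
    fix n and h :: "real ^ 'n \<Rightarrow> complex"
    assume h: "h \<in> L2_fun lborel" and z: "\<And>x. x \<notin> cball 0 R \<Longrightarrow> h x = 0"
      and orth: "\<And>f. f \<in> poly_funs n \<Longrightarrow> (\<integral>x. f x * h x \<partial>lborel) = 0"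
    define m where "m = Suc n"
    have m: "real m \<ge> 1" by (simp add: m_def)
    let ?N = "L2_fnorm lborel h"
    have N: "?N \<ge> 0" by (rule L2_fnorm_nonneg)
    have h1: "integrable lborel h" by (rule L2_fun_compact_integrable[OF h z])
    note F = fourier_L2_fun[OF h1 h]
    note [measurable] = L2_fun_measurable[OF h] L2_fun_measurable[OF F]
    define A where "A = c * exp (- real m) * ?N"
    have A: "A \<ge> 0" using c N by (simp add: A_def)
    have low: "cmod (fourier h \<xi>) \<le> A" if \<xi>: "norm \<xi> \<le> l * m" for \<xi>
    proof -
      have "(R * norm \<xi>) ^ m / fact m \<le> (R * (l * m)) ^ m / fact m"
        using R \<xi> by (intro divide_right_mono power_mono mult_left_mono) auto
      also have "\<dots> = exp (-2) ^ m * (real m ^ m / fact m)"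
        using l by (simp add: power_mult_distrib flip: mult.assoc)
      also have "\<dots> \<le> exp (-2) ^ m * exp (real m)"
        by (intro mult_left_mono power_div_fact_le_exp) auto
      also have "\<dots> = exp (- real m)"
        by (simp add: exp_of_nat_mult[symmetric] exp_add[symmetric])
      finally have *: "(R * norm \<xi>) ^ m / fact m \<le> exp (- real m)" .
      have "cmod (fourier h \<xi>) \<le> (2 * pi) powr (- real CARD('n) / 2) *
          ((R * norm \<xi>) ^ m / fact m * (\<integral>x. cmod (h x) \<partial>lborel))"
        unfolding m_def by (rule fourier_low_frequency[OF h z orth])
      also have "\<dots> \<le> (2 * pi) powr (- real CARD('n) / 2) * (exp (- real m) * (sqrt (measure lborel (cball 0 R :: (real ^ 'n) set)) * ?N))"
        using R by (intro mult_left_mono mult_mono * integral_cmod_le_L2_fnorm[OF h z]) auto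
      finally show ?thesis by (simp add: A_def c_def mult_ac)
    qed
    define w where "w \<xi> = (1 + (norm \<xi>)\<^sup>2) powr (- s / 2)" for \<xi> :: "real ^ 'n"
    have [measurable]: "w \<in> borel_measurable borel" unfolding w_def by measurable
    have w1: "0 \<le> w \<xi>" "w \<xi> \<le> 1" for \<xi>
      using s powr_mono2'[of "- s / 2" 1 "1 + (norm \<xi>)\<^sup>2"] by (auto simp: w_def)
    have high: "(w \<xi>)\<^sup>2 \<le> (l * m) powr (- 2 * s)" if "\<not> norm \<xi> \<le> l * m" for \<xi>
    proof -
      have "(l * m)\<^sup>2 \<le> 1 + (norm \<xi>)\<^sup>2"
      proof -
        have "(l * m)\<^sup>2 \<le> (norm \<xi>)\<^sup>2" using that l by (intro power_mono) auto
        then show ?thesis by simp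
      qed
      moreover have "(l * m)\<^sup>2 > 0" using l m by auto
      ultimately have "(1 + (norm \<xi>)\<^sup>2) powr (- s) \<le> ((l * m)\<^sup>2) powr (- s)"
        using s by (intro powr_mono2') auto
      also have "\<dots> = (l * m) powr (- 2 * s)"
        using l m by (simp add: powr_powr flip: powr_numeral)
      finally show ?thesis by (simp add: w_def power2_eq_square flip: powr_add)
    qed
    let ?g = "\<lambda>\<xi>. complex_of_real (w \<xi>) * fourier h \<xi>"
    have pw: "(cmod (?g \<xi>))\<^sup>2 \<le> A\<^sup>2 * indicator (cball 0 (l * m)) \<xi> + (l * m) powr (- 2 * s) * (cmod (fourier h \<xi>))\<^sup>2" for \<xi>
    proof (cases "norm \<xi> \<le> l * m")
      case True
      have "cmod (?g \<xi>) \<le> 1 * A"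
        unfolding norm_mult using w1[of \<xi>] low[OF True] by (intro mult_mono) auto
      then have "(cmod (?g \<xi>))\<^sup>2 \<le> A\<^sup>2" by (intro power_mono) auto
      with True show ?thesis by (simp add: add_increasing2)
    next
      case False
      then show ?thesis
        using mult_right_mono[OF high[OF False], of "(cmod (fourier h \<xi>))\<^sup>2"]
        by (simp add: norm_mult power_mult_distrib)
    qed
    have i1: "integrable lborel (\<lambda>\<xi>::real ^ 'n. A\<^sup>2 * indicator (cball 0 (l * m)) \<xi>)"
      using emeasure_bounded_finite[of "cball (0::real ^ 'n) (l * m)"] by auto
    have i2: "integrable lborel (\<lambda>\<xi>. (l * m) powr (- 2 * s) * (cmod (fourier h \<xi>))\<^sup>2)"
      using L2_fun_integrable[OF F] by simp
    have gi: "integrable lborel (\<lambda>\<xi>. (cmod (?g \<xi>))\<^sup>2)"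
    proof (rule Bochner_Integration.integrable_bound[OF Bochner_Integration.integrable_add[OF i1 i2]])
      show "AE \<xi> in lborel. norm ((cmod (?g \<xi>))\<^sup>2) \<le> norm (A\<^sup>2 * indicator (cball 0 (l * m)) \<xi> + (l * m) powr (- 2 * s) * (cmod (fourier h \<xi>))\<^sup>2)"
        unfolding real_norm_def abs_power2 by (intro always_eventually allI order_trans[OF pw abs_ge_self])
    qed measurable
    then have gL: "?g \<in> L2_fun lborel" by (simp add: L2_fun_def)
    have vol: "measure lborel (cball 0 (l * m) :: (real ^ 'n) set) = V * (l ^ d * real m ^ d)"
      using l content_cball[of "l * m" "0 :: real ^ 'n"] by (simp add: V_def d_def power_mult_distrib)
    have "(L2_fnorm lborel ?g)\<^sup>2 \<le> (\<integral>\<xi>. A\<^sup>2 * indicator (cball 0 (l * m)) \<xi> + (l * m) powr (- 2 * s) * (cmod (fourier h \<xi>))\<^sup>2 \<partial>lborel)"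
      unfolding L2_fnorm_square by (rule integral_mono[OF gi Bochner_Integration.integrable_add[OF i1 i2] pw])
    also have "\<dots> = A\<^sup>2 * measure lborel (cball 0 (l * m) :: (real ^ 'n) set) + (l * m) powr (- 2 * s) * (L2_fnorm lborel (fourier h))\<^sup>2"
      by (subst Bochner_Integration.integral_add[OF i1 i2]) (simp add: L2_fnorm_square)
    also have "\<dots> \<le> A\<^sup>2 * (V * (l ^ d * real m ^ d)) + (l * m) powr (- 2 * s) * ?N\<^sup>2"
      unfolding vol using L2_fnorm_fourier_le[OF h1 h]
      by (intro add_left_mono mult_left_mono power_mono) (auto simp: L2_fnorm_nonneg)
    also have "A\<^sup>2 * (V * (l ^ d * real m ^ d)) \<le> c\<^sup>2 * (V * l ^ d) * fact j * real m powr (- 2 * s) * ?N\<^sup>2"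
    proof -
      have "real m ^ d * exp (- real m) \<le> fact j * real m powr (- 2 * s)"
      proof -
        have "real m ^ d * real m powr (2 * s) = real m powr (d + 2 * s)"
          using m by (simp add: powr_add powr_realpow)
        also have "\<dots> \<le> real m powr j"
          using m s by (intro powr_mono) (auto simp: j_def)
        also have "\<dots> = real m ^ j" using m by (simp add: powr_realpow)
        also have "\<dots> \<le> fact j * exp (real m)"
          using power_div_fact_le_exp[of "real m" j] by (simp add: field_simps)
        finally show ?thesis using m by (simp add: exp_minus powr_minus field_simps)
      qed
      \<comment> \<open>The square of \<open>A\<close> contains two factors
        \<open>exp (- real m)\<close>: one absorbs the volume and the powers of m, the other is
        bounded by 1.\<close>
      then have "c\<^sup>2 * (V * l ^ d) * ?N\<^sup>2 * exp (- real m) * (real m ^ d * exp (- real m)) \<le> c\<^sup>2 * (V * l ^ d) * ?N\<^sup>2 * 1 * (fact j * real m powr (- 2 * s))"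
        using V l by (intro mult_mono[OF mult_left_mono]) (auto intro!: mult_nonneg_nonneg)
      then show ?thesis by (simp add: A_def power2_eq_square mult_ac)
    qed
    also have "c\<^sup>2 * (V * l ^ d) * fact j * real m powr (- 2 * s) * ?N\<^sup>2 + (l * m) powr (- 2 * s) * ?N\<^sup>2 = K2 * real m powr (- 2 * s) * ?N\<^sup>2"
      using l m by (simp add: K2_def powr_mult distrib_right)
    also have "\<dots> = (sqrt K2 * real m powr (- s) * ?N)\<^sup>2"
    proof -
      have "real m powr (- 2 * s) = (real m powr (- s))\<^sup>2"
        by (simp add: power2_eq_square flip: powr_add)
      then show ?thesis using K2 by (simp add: power_mult_distrib)
    qed
    finally have "L2_fnorm lborel ?g \<le> sqrt K2 * real m powr (- s) * ?N"
      by (rule power2_le_imp_le) (use K2 N in \<open>auto intro!: mult_nonneg_nonneg\<close>)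
    with gL show "(\<lambda>\<xi>. complex_of_real ((1 + (norm \<xi>)\<^sup>2) powr (- s / 2)) * fourier h \<xi>) \<in> L2_fun lborel \<and>
      L2_fnorm lborel (\<lambda>\<xi>. complex_of_real ((1 + (norm \<xi>)\<^sup>2) powr (- s / 2)) * fourier h \<xi>)
        \<le> sqrt K2 * real (Suc n) powr (- s) * ?N"
      by (simp add: w_def m_def)
  qed
qed

text \<open>The duality between the Sobolev spaces of order s and -s: after Parseval the weight is
  split between the two transforms and Cauchy-Schwarz is applied.\<close>

lemma Hs_pairing_estimate:
  fixes R s :: real
  assumes R: "R > 0" and s: "s > 0"
  obtains K where "K > 0"
    "\<And>n (h :: real ^ 'n \<Rightarrow> complex) U. h \<in> L2_fun lborel \<Longrightarrow> (\<And>x. x \<notin> cball 0 R \<Longrightarrow> h x = 0) \<Longrightarrow>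
      (\<And>f. f \<in> poly_funs n \<Longrightarrow> (\<integral>x. f x * h x \<partial>lborel) = 0) \<Longrightarrow> U \<in> Hs_space s \<Longrightarrow>
      cmod (\<integral>x. U x * cnj (h x) \<partial>lborel) \<le> K * real (Suc n) powr (- s) * L2_fnorm lborel h * Hs_space_norm s U"
proof -
  obtain K where K: "K > 0" and
    KF: "\<And>n (h :: real ^ 'n \<Rightarrow> complex). h \<in> L2_fun lborel \<Longrightarrow> (\<And>x. x \<notin> cball 0 R \<Longrightarrow> h x = 0) \<Longrightarrow>
      (\<And>f. f \<in> poly_funs n \<Longrightarrow> (\<integral>x. f x * h x \<partial>lborel) = 0) \<Longrightarrow>
      (\<lambda>\<xi>. complex_of_real ((1 + (norm \<xi>)\<^sup>2) powr (- s / 2)) * fourier h \<xi>) \<in> L2_fun lborel \<and>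
      L2_fnorm lborel (\<lambda>\<xi>. complex_of_real ((1 + (norm \<xi>)\<^sup>2) powr (- s / 2)) * fourier h \<xi>)
        \<le> K * real (Suc n) powr (- s) * L2_fnorm lborel h"
    by (rule fourier_weighted_estimate[OF R s]) blast
  show ?thesis
  proof (rule that[OF K])
    fix n and h U :: "real ^ 'n \<Rightarrow> complex"
    assume h: "h \<in> L2_fun lborel" and z: "\<And>x. x \<notin> cball 0 R \<Longrightarrow> h x = 0"
      and orth: "\<And>f. f \<in> poly_funs n \<Longrightarrow> (\<integral>x. f x * h x \<partial>lborel) = 0" and U: "U \<in> Hs_space s"
    from U obtain g0 where g0: "has_fourier U g0"
      and g0i: "integrable lborel (\<lambda>\<xi>. (1 + (norm \<xi>)\<^sup>2) powr s * (cmod (g0 \<xi>))\<^sup>2)"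
      unfolding Hs_space_def by blast
    \<comment> \<open>This is the transform that \<open>Hs_space_norm\<close> measures; its weighted
      integrability is inherited from \<open>g0\<close> by uniqueness almost everywhere.\<close>
    define g where "g = (SOME g. has_fourier U g)"
    have g: "has_fourier U g" unfolding g_def by (rule someI[of "has_fourier U", OF g0])
    have [measurable]: "g \<in> borel_measurable borel" "g0 \<in> borel_measurable borel"
      using g g0 by (auto simp: has_fourier_def dest: L2_fun_measurable)
    have gi: "integrable lborel (\<lambda>\<xi>. (1 + (norm \<xi>)\<^sup>2) powr s * (cmod (g \<xi>))\<^sup>2)"
      using has_fourier_unique[OF g0 g] by (intro integrable_cong_AE_imp[OF g0i]) (auto elim: eventually_mono)
    let ?g = "\<lambda>\<xi>. complex_of_real ((1 + (norm \<xi>)\<^sup>2) powr (s / 2)) * g \<xi>"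
    let ?F = "\<lambda>\<xi>. complex_of_real ((1 + (norm \<xi>)\<^sup>2) powr (- s / 2)) * fourier h \<xi>"
    have sq: "(cmod (?g \<xi>))\<^sup>2 = (1 + (norm \<xi>)\<^sup>2) powr s * (cmod (g \<xi>))\<^sup>2" for \<xi>
      by (simp add: norm_mult power_mult_distrib power2_eq_square[of "_ powr _"] flip: powr_add)
    have gL: "?g \<in> L2_fun lborel"
      using gi by (simp add: L2_fun_def sq)
    have gN: "L2_fnorm lborel ?g = Hs_space_norm s U"
      by (simp add: L2_fnorm_def Hs_space_norm_def sq Let_def flip: g_def)
    have cancel: "?g \<xi> * cnj (?F \<xi>) = g \<xi> * cnj (fourier h \<xi>)" for \<xi>
    proof -
      have pos: "1 + (norm \<xi>)\<^sup>2 > 0" by (simp add: add_pos_nonneg)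
      then have "(1 + (norm \<xi>)\<^sup>2) powr (s / 2) * (1 + (norm \<xi>)\<^sup>2) powr (- s / 2) = 1"
        by (simp flip: powr_add)
      then have "complex_of_real ((1 + (norm \<xi>)\<^sup>2) powr (s / 2)) * complex_of_real ((1 + (norm \<xi>)\<^sup>2) powr (- s / 2)) = 1"
        by (metis of_real_1 of_real_mult)
      moreover have "(a * g \<xi>) * cnj (b * fourier h \<xi>) = (a * cnj b) * (g \<xi> * cnj (fourier h \<xi>))" for a b
        by (simp add: mult_ac)
      ultimately show ?thesis by simp
    qed
    have "cmod (\<integral>x. U x * cnj (h x) \<partial>lborel) = cmod (\<integral>\<xi>. ?g \<xi> * cnj (?F \<xi>) \<partial>lborel)"
      unfolding cancel using has_fourier_Parseval[OF g h z] by (rule arg_cong)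
    also have "\<dots> \<le> L2_fnorm lborel ?g * L2_fnorm lborel ?F"
      using KF[OF h z orth] by (intro L2_Cauchy_Schwarz gL) auto
    also have "\<dots> \<le> Hs_space_norm s U * (K * real (Suc n) powr (- s) * L2_fnorm lborel h)"
      unfolding gN[symmetric] using KF[OF h z orth] by (intro mult_left_mono L2_fnorm_nonneg) auto
    finally show "cmod (\<integral>x. U x * cnj (h x) \<partial>lborel) \<le> K * real (Suc n) powr (- s) * L2_fnorm lborel h * Hs_space_norm s U"
      by (simp add: mult_ac)
  qed
qed

section \<open>Borel measures and projections on $L^2$ of the ball\<close>

lemma restrict0_scaleR: "indicator A x *\<^sub>R f x = restrict0 A f x"
  by (simp add: restrict0_def indicator_def)

lemma integral_ball:
  fixes f :: "real ^ 'n \<Rightarrow> complex"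
  shows "(\<integral>x. f x \<partial>ball_measure R) = (\<integral>x. restrict0 (cball 0 R) f x \<partial>lborel)"
  unfolding ball_measure_def by (simp add: integral_restrict_space restrict0_scaleR)

lemma space_ball_measure [simp]: "space (ball_measure R) = cball 0 R"
  by (simp add: ball_measure_def space_restrict_space)

lemma measurable_ball_iff:
  fixes f :: "real ^ 'n \<Rightarrow> complex"
  shows "f \<in> borel_measurable (ball_measure R) \<longleftrightarrow> restrict0 (cball 0 R) f \<in> borel_measurable borel"
proof -
  have "f \<in> borel_measurable (ball_measure R) \<longleftrightarrow> (\<lambda>x. indicator (cball 0 R) x *\<^sub>R f x) \<in> borel_measurable lborel"
    unfolding ball_measure_def by (rule borel_measurable_restrict_space_iff) simp
  then show ?thesis by (simp add: restrict0_scaleR[abs_def])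
qed

lemma cmod_restrict0: "(cmod (restrict0 A f x))\<^sup>2 = indicator A x *\<^sub>R (cmod (f x))\<^sup>2"
  by (simp add: restrict0_def indicator_def)

lemma
  fixes f :: "real ^ 'n \<Rightarrow> complex"
  shows L2_fun_ball_iff: "f \<in> L2_fun (ball_measure R) \<longleftrightarrow> restrict0 (cball 0 R) f \<in> L2_fun lborel"
    and L2_fnorm_ball: "L2_fnorm (ball_measure R) f = L2_fnorm lborel (restrict0 (cball 0 R) f)"
  unfolding L2_fun_def L2_fnorm_def mem_Collect_eq measurable_ball_iff cmod_restrict0
  by (simp_all add: ball_measure_def integrable_restrict_space integral_restrict_space)

lemma L2_element:
  assumes u: "u \<in> L2 M" and f: "f \<in> u"
  shows "f \<in> L2_fun M" "AE x in M. f x = L2_rep u x"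
proof -
  have "(f, L2_rep u) \<in> L2_rel M"
    using in_quotient_imp_in_rel[OF equiv_L2_rel] u f L2_rep_in[OF u] unfolding L2_def by blast
  then show "f \<in> L2_fun M" "AE x in M. f x = L2_rep u x" by (auto simp: L2_rel_def)
qed

lemma L2_rep_class:
  assumes f: "f \<in> L2_fun M"
  shows "AE x in M. f x = L2_rep (L2_class M f) x"
proof -
  have "f \<in> L2_class M f" using f by (simp add: L2_class_def L2_rel_def)
  then show ?thesis by (rule L2_element(2)[OF L2_class_in[OF f]])
qed

section \<open>Borel sets, Lipschitz functionals and supports in L^2\<close>

lemma space_L2_borel [simp]: "space (L2_borel M) = L2 M"
  by (auto simp: L2_borel_def L2_topology_def Metric_space.openin_mtopology[OF Metric_space_L2] intro!: space_measure_of)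

lemma open_in_sets_L2_borel: "openin (L2_topology M) U \<Longrightarrow> U \<in> sets (L2_borel M)"
  unfolding L2_borel_def
  by (subst sets_measure_of)
     (auto simp: L2_topology_def Metric_space.openin_mtopology[OF Metric_space_L2])

text \<open>Near a point the functional cannot climb past a given level, so its strict sublevel sets
  are open in the metric and belong to \<open>L2_borel\<close>.\<close>

lemma borel_measurable_L2_Lipschitz:
  assumes L: "\<And>u v. u \<in> L2 M \<Longrightarrow> v \<in> L2 M \<Longrightarrow> N u \<le> N v + C * L2_dist M v u"
  shows "N \<in> borel_measurable (L2_borel M)"
proof (rule borel_measurableI_less)
  fix a :: real
  interpret Metric_space "L2 M" "L2_dist M" by (rule Metric_space_L2)
  have "openin mtopology {v \<in> L2 M. N v < a}"
    unfolding openin_mtopology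
  proof (intro conjI allI impI)
    fix v assume v: "v \<in> {v \<in> L2 M. N v < a}"
    \<comment> \<open>The divisor is positive whatever the sign of \<open>C\<close>.\<close>
    define r where "r = (a - N v) / (\<bar>C\<bar> + 1)"
    have r: "r > 0" using v by (simp add: r_def add_nonneg_pos)
    have "mball v r \<subseteq> {v \<in> L2 M. N v < a}"
    proof
      fix u assume u: "u \<in> mball v r"
      then have *: "u \<in> L2 M" "v \<in> L2 M" "L2_dist M v u < r" by auto
      have "C * L2_dist M v u \<le> (\<bar>C\<bar> + 1) * L2_dist M v u"
        by (intro mult_right_mono) auto
      also have "\<dots> < (\<bar>C\<bar> + 1) * r"
        using * by (intro mult_strict_left_mono) auto
      also have "\<dots> = a - N v" by (simp add: r_def)
      finally show "u \<in> {v \<in> L2 M. N v < a}" using L[OF *(1,2)] * by simp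
    qed
    with r show "\<exists>r>0. mball v r \<subseteq> {v \<in> L2 M. N v < a}" by blast
  qed auto
  then show "{x \<in> space (L2_borel M). N x < a} \<in> sets (L2_borel M)"
    by (auto intro!: open_in_sets_L2_borel simp: L2_topology_def)
qed

text \<open>A point outside the support has a null neighbourhood, which contains a null ball with
  centre in \<open>D\<close> and radius 1/(k+1) around that point. There are only countably many
  such balls, so their union is null.\<close>

lemma AE_in_L2_supp:
  assumes D: "countable D" "D \<subseteq> L2 M" "\<And>v e. v \<in> L2 M \<Longrightarrow> e > 0 \<Longrightarrow> \<exists>u\<in>D. L2_dist M v u < e"
    and \<nu>: "sets \<nu> = sets (L2_borel M)"
  shows "AE v in \<nu>. v \<in> L2_supp M \<nu>"
proof -
  interpret Metric_space "L2 M" "L2_dist M" by (rule Metric_space_L2)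
  define F where "F = {p \<in> D \<times> (UNIV :: nat set). emeasure \<nu> (mball (fst p) (1 / Suc (snd p))) = 0}"
  let ?b = "\<lambda>p. mball (fst p) (1 / Suc (snd p))"
  have ball: "mball u r \<in> sets \<nu>" for u r
    unfolding \<nu> by (rule open_in_sets_L2_borel) (simp add: L2_topology_def)
  have "countable F"
    unfolding F_def using D(1) by (intro countable_subset[OF _ countable_SIGMA[of D "\<lambda>_. UNIV"]]) auto
  then have null: "(\<Union>p\<in>F. ?b p) \<in> null_sets \<nu>"
    by (rule null_sets_UN') (use ball in \<open>auto simp: F_def\<close>)
  have "{v \<in> space \<nu>. v \<notin> L2_supp M \<nu>} \<subseteq> (\<Union>p\<in>F. ?b p)"
  proof
    fix v assume "v \<in> {v \<in> space \<nu>. v \<notin> L2_supp M \<nu>}"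
    then have v: "v \<in> L2 M" and "v \<notin> L2_supp M \<nu>"
      using sets_eq_imp_space_eq[OF \<nu>] by auto
    then obtain U where U: "openin mtopology U" "v \<in> U" "emeasure \<nu> U = 0"
      unfolding L2_supp_def L2_topology_def by (auto simp: zero_less_iff_neq_zero)
    then obtain r where r: "r > 0" "mball v r \<subseteq> U" unfolding openin_mtopology by blast
    \<comment> \<open>Half of \<open>r\<close>, because the distance from \<open>v\<close> to a
      point of the ball around \<open>u\<close> is the sum of two distances below 1/(k+1).\<close>
    obtain k :: nat where k: "1 / Suc k < r / 2"
      using reals_Archimedean[of "r / 2"] r by (auto simp: inverse_eq_divide)
    obtain u where u: "u \<in> D" "L2_dist M v u < 1 / Suc k" using D(3)[OF v, of "1 / Suc k"] by auto
    have uL: "u \<in> L2 M" using u D(2) by blast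
    have "mball u (1 / Suc k) \<subseteq> mball v r"
    proof
      fix w assume w: "w \<in> mball u (1 / Suc k)"
      then show "w \<in> mball v r" using triangle[of v u w] v uL u(2) k by auto
    qed
    with r have "emeasure \<nu> (mball u (1 / Suc k)) \<le> emeasure \<nu> U"
      using U(1) by (intro emeasure_mono) (auto simp: \<nu> L2_topology_def intro!: open_in_sets_L2_borel)
    with U(3) u(1) have "(u, k) \<in> F" by (simp add: F_def)
    moreover have "v \<in> ?b (u, k)" using v uL u(2) by (simp add: commute)
    ultimately show "v \<in> (\<Union>p\<in>F. ?b p)" by blast
  qed
  with null show ?thesis by (rule AE_I')
qed

section \<open>Coefficients, residuals and separability\<close>

definition phic :: "(nat \<Rightarrow> 'a \<Rightarrow> real) \<Rightarrow> nat \<Rightarrow> 'a \<Rightarrow> complex" where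
  "phic \<phi> k x = complex_of_real (\<phi> k x)"

definition coef :: "'a measure \<Rightarrow> (nat \<Rightarrow> 'a \<Rightarrow> real) \<Rightarrow> ('a \<Rightarrow> complex) \<Rightarrow> nat \<Rightarrow> complex" where
  "coef M \<phi> w k = (\<integral>x. w x * cnj (phic \<phi> k x) \<partial>M)"

text \<open>The projection error at the level of functions. Representatives are chosen only once, in
  \<open>L2_dist_onb_proj\<close>, and all estimates are free of equivalence classes.\<close>

definition residual :: "'a measure \<Rightarrow> (nat \<Rightarrow> 'a \<Rightarrow> real) \<Rightarrow> nat \<Rightarrow> ('a \<Rightarrow> complex) \<Rightarrow> 'a \<Rightarrow> complex" where
  "residual M \<phi> r w x = w x - (\<Sum>k<r. coef M \<phi> w k * phic \<phi> k x)"

lemma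
  assumes "poly_onb R (\<phi> :: nat \<Rightarrow> real ^ 'n \<Rightarrow> real)"
  shows phic_L2_fun: "phic \<phi> k \<in> L2_fun (ball_measure R)"
    and phic_orthonormal: "(\<integral>x. phic \<phi> j x * cnj (phic \<phi> k x) \<partial>ball_measure R) = (if j = k then 1 else 0)"
    and phic_fnorm: "L2_fnorm (ball_measure R) (phic \<phi> k) = 1"
proof -
  have m [measurable]: "\<phi> k \<in> borel_measurable (ball_measure R)" and i: "integrable (ball_measure R) (\<lambda>x. (\<phi> k x)\<^sup>2)"
    and o: "(\<integral>x. \<phi> j x * \<phi> k x \<partial>ball_measure R) = (if j = k then 1 else 0)" for j k
    using assms by (auto simp: poly_onb_def)
  have "phic \<phi> k \<in> borel_measurable (ball_measure R)"
    unfolding phic_def[abs_def] by measurable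
  then show "phic \<phi> k \<in> L2_fun (ball_measure R)"
    using i[of k] by (simp add: L2_fun_def phic_def)
  have "(\<integral>x. phic \<phi> j x * cnj (phic \<phi> k x) \<partial>ball_measure R) = (\<integral>x. complex_of_real (\<phi> j x * \<phi> k x) \<partial>ball_measure R)"
    by (simp add: phic_def)
  also have "\<dots> = (if j = k then 1 else 0)"
    unfolding integral_complex_of_real o by simp
  finally show "(\<integral>x. phic \<phi> j x * cnj (phic \<phi> k x) \<partial>ball_measure R) = (if j = k then 1 else 0)" .
  show "L2_fnorm (ball_measure R) (phic \<phi> k) = 1"
    using o[of k k] by (simp add: L2_fnorm_def phic_def power2_eq_square)
qed

lemma coef_bound:
  assumes "poly_onb R \<phi>" "w \<in> L2_fun (ball_measure R)"
  shows "cmod (coef (ball_measure R) \<phi> w k) \<le> L2_fnorm (ball_measure R) w"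
  using L2_Cauchy_Schwarz[OF assms(2) phic_L2_fun[OF assms(1), of k]]
  by (simp add: coef_def phic_fnorm[OF assms(1)])

lemma coef_diff:
  assumes "poly_onb R \<phi>" "v \<in> L2_fun (ball_measure R)" "w \<in> L2_fun (ball_measure R)"
  shows "coef (ball_measure R) \<phi> (\<lambda>x. v x - w x) k = coef (ball_measure R) \<phi> v k - coef (ball_measure R) \<phi> w k"
  unfolding coef_def left_diff_distrib
  by (intro Bochner_Integration.integral_diff L2_fun_mult_integrable phic_L2_fun assms)

lemma phic_sum_L2_fun:
  assumes "poly_onb R \<phi>"
  shows "(\<lambda>x. \<Sum>k<r. c k * phic \<phi> k x) \<in> L2_fun (ball_measure R)"
  by (intro L2_fun_sum L2_fun_scale phic_L2_fun assms)

lemma phic_sum_fnorm_le: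
  assumes "poly_onb R \<phi>"
  shows "L2_fnorm (ball_measure R) (\<lambda>x. \<Sum>k<r. c k * phic \<phi> k x) \<le> (\<Sum>k<r. cmod (c k))"
  using L2_fnorm_sum_le[of "{..<r}" "\<lambda>k x. c k * phic \<phi> k x" "ball_measure R"]
  by (simp add: L2_fun_scale phic_L2_fun[OF assms] L2_fnorm_scale phic_fnorm[OF assms])

lemma residual_L2_fun:
  assumes "poly_onb R \<phi>" "w \<in> L2_fun (ball_measure R)"
  shows "residual (ball_measure R) \<phi> r w \<in> L2_fun (ball_measure R)"
  unfolding residual_def[abs_def] by (intro L2_fun_diff assms phic_sum_L2_fun)

text \<open>Serves the measurability of the error as a function of \<open>v\<close>. The constant
  comes from bounding each of the r coefficients of the difference by its norm.\<close>

lemma residual_Lipschitz: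
  assumes \<phi>: "poly_onb R \<phi>" and v: "v \<in> L2_fun (ball_measure R)" and w: "w \<in> L2_fun (ball_measure R)"
  shows "L2_fnorm (ball_measure R) (residual (ball_measure R) \<phi> r v)
    \<le> L2_fnorm (ball_measure R) (residual (ball_measure R) \<phi> r w)
      + (1 + real r) * L2_fnorm (ball_measure R) (\<lambda>x. w x - v x)"
proof -
  let ?B = "ball_measure R"
  let ?d = "\<lambda>x. v x - w x"
  have d: "?d \<in> L2_fun ?B" by (rule L2_fun_diff[OF v w])
  let ?S = "\<lambda>x. \<Sum>k<r. - coef ?B \<phi> ?d k * phic \<phi> k x"
  have S: "?S \<in> L2_fun ?B" by (rule phic_sum_L2_fun[OF \<phi>])
  have dn: "L2_fnorm ?B ?d = L2_fnorm ?B (\<lambda>x. w x - v x)"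
    by (simp add: L2_fnorm_def norm_minus_commute)
  have "residual ?B \<phi> r v = (\<lambda>x. residual ?B \<phi> r w x + (?d x + ?S x))"
    by (simp add: fun_eq_iff residual_def coef_diff[OF \<phi> v w] left_diff_distrib sum_subtractf sum_negf)
  then have "L2_fnorm ?B (residual ?B \<phi> r v) \<le> L2_fnorm ?B (residual ?B \<phi> r w) + (L2_fnorm ?B ?d + L2_fnorm ?B ?S)"
    using L2_fnorm_triangle[OF residual_L2_fun[OF \<phi> w, of r] L2_fun_add[OF d S]] L2_fnorm_triangle[OF d S] by simp
  also have "L2_fnorm ?B ?S \<le> (\<Sum>k<r. L2_fnorm ?B ?d)"
    by (rule order_trans[OF phic_sum_fnorm_le[OF \<phi>]], rule sum_mono) (simp add: coef_bound[OF \<phi> d])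
  finally show ?thesis by (simp add: dn distrib_right)
qed

text \<open>Replacing the chosen representatives of the basis classes and of the projection by the
  explicit functions alters the integrands only on null sets.\<close>

lemma L2_dist_onb_proj:
  assumes \<phi>: "poly_onb R \<phi>" and v: "v \<in> L2 (ball_measure R)"
  shows "L2_dist (ball_measure R) (onb_proj R \<phi> r v) v
      = L2_fnorm (ball_measure R) (residual (ball_measure R) \<phi> r (L2_rep v))"
proof -
  let ?B = "ball_measure R"
  let ?S = "\<lambda>x. \<Sum>k<r. coef ?B \<phi> (L2_rep v) k * phic \<phi> k x"
  have S: "?S \<in> L2_fun ?B" by (rule phic_sum_L2_fun[OF \<phi>])
  have w: "L2_rep v \<in> L2_fun ?B" by (rule L2_rep_fun[OF v])
  have "L2_inner ?B v (L2_class ?B (phic \<phi> k)) = coef ?B \<phi> (L2_rep v) k" for k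
  proof -
    have c: "L2_rep (L2_class ?B (phic \<phi> k)) \<in> L2_fun ?B"
      by (intro L2_rep_fun L2_class_in phic_L2_fun \<phi>)
    show ?thesis
      unfolding L2_inner_def coef_def
      using L2_rep_class[OF phic_L2_fun[OF \<phi>, of k]]
        borel_measurable_integrable[OF L2_fun_mult_integrable[OF w c]]
        borel_measurable_integrable[OF L2_fun_mult_integrable[OF w phic_L2_fun[OF \<phi>, of k]]]
      by (intro integral_cong_AE) (auto elim: eventually_mono)
  qed
  then have P: "onb_proj R \<phi> r v = L2_class ?B ?S"
    by (simp add: onb_proj_def phic_def[abs_def])
  have "L2_dist ?B (onb_proj R \<phi> r v) v = L2_fnorm ?B (\<lambda>x. ?S x - L2_rep v x)"
    unfolding L2_dist_def P
    using L2_rep_class[OF S]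
    by (intro L2_fnorm_cong_AE L2_fun_diff S w L2_rep_fun L2_class_in) (auto elim: eventually_mono)
  also have "\<dots> = L2_fnorm ?B (residual ?B \<phi> r (L2_rep v))"
    by (simp add: L2_fnorm_def residual_def norm_minus_commute)
  finally show "L2_dist ?B (onb_proj R \<phi> r v) v = L2_fnorm ?B (residual ?B \<phi> r (L2_rep v))" .
qed

lemma residual_orthogonal:
  assumes \<phi>: "poly_onb R \<phi>" and w: "w \<in> L2_fun (ball_measure R)" and j: "j < r"
  shows "(\<integral>x. residual (ball_measure R) \<phi> r w x * cnj (phic \<phi> j x) \<partial>ball_measure R) = 0"
proof -
  let ?B = "ball_measure R"
  have "(\<integral>x. residual ?B \<phi> r w x * cnj (phic \<phi> j x) \<partial>?B)
      = coef ?B \<phi> w j - (\<integral>x. (\<Sum>k<r. coef ?B \<phi> w k * phic \<phi> k x) * cnj (phic \<phi> j x) \<partial>?B)"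
    unfolding residual_def left_diff_distrib coef_def[of _ _ w j]
    by (intro Bochner_Integration.integral_diff L2_fun_mult_integrable phic_sum_L2_fun phic_L2_fun \<phi> w)
  also have "(\<integral>x. (\<Sum>k<r. coef ?B \<phi> w k * phic \<phi> k x) * cnj (phic \<phi> j x) \<partial>?B)
      = (\<Sum>k<r. coef ?B \<phi> w k * (\<integral>x. phic \<phi> k x * cnj (phic \<phi> j x) \<partial>?B))"
    unfolding sum_distrib_right mult.assoc
    by (subst Bochner_Integration.integral_sum) (auto intro!: L2_fun_mult_integrable phic_L2_fun \<phi>)
  also have "\<dots> = coef ?B \<phi> w j"
    using j by (simp add: phic_orthonormal[OF \<phi>] if_distrib[of "(*) _"] cong: if_cong)
  finally show ?thesis by simp
qed

text \<open>Completeness in \<open>poly_onb\<close> concerns real functions. Since the basis is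
  real, coefficients and residual split into real and imaginary parts, to which it applies
  separately.\<close>

lemma residual_tendsto_0:
  assumes \<phi>: "poly_onb R \<phi>" and w: "w \<in> L2_fun (ball_measure R)"
  shows "(\<lambda>N. L2_fnorm (ball_measure R) (residual (ball_measure R) \<phi> N w)) \<longlonglongrightarrow> 0"
proof -
  let ?B = "ball_measure R"
  note [measurable] = L2_fun_measurable[OF w]
  define E where "E f N x = (f x - (\<Sum>k<N. (\<integral>y. f y * \<phi> k y \<partial>?B) * \<phi> k x))\<^sup>2" for f N x
  have wi: "integrable ?B (\<lambda>x. (cmod (w x))\<^sup>2)" by (rule L2_fun_integrable[OF w])
  have Ri: "integrable ?B (\<lambda>x. (Re (w x))\<^sup>2)" and Ii: "integrable ?B (\<lambda>x. (Im (w x))\<^sup>2)"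
    by (rule Bochner_Integration.integrable_bound[OF wi]; simp add: cmod_power2)+
  have conv: "(\<lambda>N. \<integral>x. E f N x \<partial>?B) \<longlonglongrightarrow> 0"
    if "f \<in> borel_measurable ?B" "integrable ?B (\<lambda>x. (f x)\<^sup>2)" for f
    using \<phi> that unfolding poly_onb_def E_def by blast
  have wp: "integrable ?B (\<lambda>x. w x * cnj (phic \<phi> k x))" for k
    by (intro L2_fun_mult_integrable w phic_L2_fun \<phi>)
  have c: "Re (coef ?B \<phi> w k) = (\<integral>y. Re (w y) * \<phi> k y \<partial>?B)" "Im (coef ?B \<phi> w k) = (\<integral>y. Im (w y) * \<phi> k y \<partial>?B)" for k
    using integral_Re[OF wp[of k]] integral_Im[OF wp[of k]] by (simp_all add: coef_def phic_def)
  have sq: "(cmod (residual ?B \<phi> N w x))\<^sup>2 = E (\<lambda>x. Re (w x)) N x + E (\<lambda>x. Im (w x)) N x" for N x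
    by (simp add: cmod_power2 E_def residual_def c phic_def)
  have [measurable]: "\<phi> k \<in> borel_measurable ?B" for k using \<phi> by (simp add: poly_onb_def)
  have ri: "integrable ?B (\<lambda>x. (cmod (residual ?B \<phi> N w x))\<^sup>2)" for N
    by (rule L2_fun_integrable[OF residual_L2_fun[OF \<phi> w]])
  have [measurable]: "E f N \<in> borel_measurable ?B" if [measurable]: "f \<in> borel_measurable ?B" for f N
    unfolding E_def[abs_def] by measurable
  have Ei: "integrable ?B (E (\<lambda>x. Re (w x)) N)" for N
    by (rule Bochner_Integration.integrable_bound[OF ri[of N]]) (simp_all add: sq E_def)
  have Ei': "integrable ?B (E (\<lambda>x. Im (w x)) N)" for N
    by (rule Bochner_Integration.integrable_bound[OF ri[of N]]) (simp_all add: sq E_def)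
  have "(\<lambda>N. (\<integral>x. E (\<lambda>x. Re (w x)) N x \<partial>?B) + (\<integral>x. E (\<lambda>x. Im (w x)) N x \<partial>?B)) \<longlonglongrightarrow> 0 + 0"
    by (intro tendsto_add conv Ri Ii) measurable
  then have "(\<lambda>N. sqrt ((\<integral>x. E (\<lambda>x. Re (w x)) N x \<partial>?B) + (\<integral>x. E (\<lambda>x. Im (w x)) N x \<partial>?B))) \<longlonglongrightarrow> sqrt (0 + 0)"
    by (rule tendsto_real_sqrt)
  then show ?thesis
    unfolding L2_fnorm_def sq by (simp add: Ei Ei')
qed

text \<open>Finite combinations of the basis with coefficients in a countable dense set of complex
  numbers, indexed by the lists of coefficients.\<close>

lemma L2_ball_separable:
  assumes \<phi>: "poly_onb R (\<phi> :: nat \<Rightarrow> real ^ 'n \<Rightarrow> real)"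
  obtains D where "countable D" "D \<subseteq> L2 (ball_measure R :: (real ^ 'n) measure)"
    "\<And>v e. v \<in> L2 (ball_measure R) \<Longrightarrow> e > 0 \<Longrightarrow> \<exists>u\<in>D. L2_dist (ball_measure R) v u < e"
proof -
  let ?B = "ball_measure R :: (real ^ 'n) measure"
  obtain Q :: "complex set" where Q: "countable Q" "\<And>X. open X \<Longrightarrow> X \<noteq> {} \<Longrightarrow> \<exists>d\<in>Q. d \<in> X"
    by (rule countable_dense_setE) blast
  define P where "P l x = (\<Sum>k<length l. (l ! k) * phic \<phi> k x)" for l x
  have P: "P l \<in> L2_fun ?B" for l unfolding P_def[abs_def] by (rule phic_sum_L2_fun[OF \<phi>])
  show ?thesis
  proof (rule that[of "(\<lambda>l. L2_class ?B (P l)) ` lists Q"])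
    show "countable ((\<lambda>l. L2_class ?B (P l)) ` lists Q)"
      by (intro countable_image countable_lists Q)
    show "(\<lambda>l. L2_class ?B (P l)) ` lists Q \<subseteq> L2 ?B"
      using L2_class_in[OF P] by auto
    fix v and e :: real assume v: "v \<in> L2 ?B" and e: "e > 0"
    define w where "w = L2_rep v"
    have w: "w \<in> L2_fun ?B" unfolding w_def by (rule L2_rep_fun[OF v])
    have "\<forall>\<^sub>F N in sequentially. L2_fnorm ?B (residual ?B \<phi> N w) < e / 2"
      by (rule order_tendstoD(2)[OF residual_tendsto_0[OF \<phi> w]]) (use e in simp)
    then obtain N where N: "L2_fnorm ?B (residual ?B \<phi> N w) < e / 2"
      using eventually_happens'[OF sequentially_bot] by blast
    \<comment> \<open>Makes N coefficient errors add up to at most e / 2; the summand 1 covers N =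
      0.\<close>
    define \<delta> where "\<delta> = e / (2 * (real N + 1))"
    have \<delta>: "\<delta> > 0" using e by (simp add: \<delta>_def)
    have "\<exists>q\<in>Q. dist (coef ?B \<phi> w k) q < \<delta>" for k
      using Q(2)[of "ball (coef ?B \<phi> w k) \<delta>"] \<delta> by (auto simp del: dist_complex_def)
    then obtain q where q: "\<And>k. q k \<in> Q" "\<And>k. cmod (coef ?B \<phi> w k - q k) < \<delta>"
      unfolding dist_norm by metis
    define l where "l = map q [0..<N]"
    have l: "l \<in> lists Q" using q(1) by (auto simp: l_def)
    have Pl: "P l = (\<lambda>x. \<Sum>k<N. q k * phic \<phi> k x)" by (simp add: P_def[abs_def] l_def)
    let ?T = "\<lambda>x. \<Sum>k<N. (coef ?B \<phi> w k - q k) * phic \<phi> k x"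
    have T: "?T \<in> L2_fun ?B" by (rule phic_sum_L2_fun[OF \<phi>])
    have "L2_dist ?B v (L2_class ?B (P l)) = L2_fnorm ?B (\<lambda>x. w x - P l x)"
      unfolding L2_dist_def w_def using L2_rep_class[OF P, of l]
      by (intro L2_fnorm_cong_AE L2_fun_diff P L2_rep_fun[OF v] L2_rep_fun L2_class_in) (auto elim: eventually_mono)
    also have "(\<lambda>x. w x - P l x) = (\<lambda>x. residual ?B \<phi> N w x + ?T x)"
      by (simp add: fun_eq_iff residual_def Pl left_diff_distrib sum_subtractf)
    also have "L2_fnorm ?B \<dots> \<le> L2_fnorm ?B (residual ?B \<phi> N w) + L2_fnorm ?B ?T"
      by (rule L2_fnorm_triangle[OF residual_L2_fun[OF \<phi> w] T])
    also have "L2_fnorm ?B ?T \<le> (\<Sum>k<N. \<delta>)"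
      by (rule order_trans[OF phic_sum_fnorm_le[OF \<phi>]], rule sum_mono) (rule less_imp_le[OF q(2)])
    also have "(\<Sum>k<N. \<delta>) \<le> e / 2"
      using e by (simp add: \<delta>_def field_simps)
    finally have "L2_dist ?B v (L2_class ?B (P l)) < e" using N by simp
    with l show "\<exists>u\<in>(\<lambda>l. L2_class ?B (P l)) ` lists Q. L2_dist ?B v u < e" by blast
  qed
qed

section \<open>Projection error on Sobolev spaces\<close>

text \<open>The functions orthogonal to the residual form a subspace containing the first basis
  functions, hence their span, which \<open>poly_onb\<close> identifies with
  \<open>poly_ball R n\<close>.\<close>

lemma residual_orthogonal_poly:
  assumes \<phi>: "poly_onb R (\<phi> :: nat \<Rightarrow> real ^ 'n \<Rightarrow> real)" and w: "w \<in> L2_fun (ball_measure R)"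
    and f: "f \<in> poly_funs n"
  shows "(\<integral>x. f x * restrict0 (cball 0 R) (residual (ball_measure R) \<phi> (poly_dim TYPE('n) R n) w) x \<partial>lborel) = 0"
proof -
  let ?B = "ball_measure R :: (real ^ 'n) measure" and ?r = "poly_dim TYPE('n) R n"
  let ?d = "residual ?B \<phi> ?r w"
  have d: "?d \<in> L2_fun ?B" by (rule residual_L2_fun[OF \<phi> w])
  \<comment> \<open>The double conjugation gives the bilinear pairing the shape of an inner product
    with \<open>cnj (p x)\<close>, so \<open>L2_fun_mult_integrable\<close> applies.\<close>
  let ?S = "{p \<in> L2_fun ?B. (\<integral>x. ?d x * cnj (cnj (p x)) \<partial>?B) = 0}"
  have cL: "(\<lambda>x. cnj (p x)) \<in> L2_fun ?B" if "p \<in> L2_fun ?B" for p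
    using that by (auto simp: L2_fun_def)
  have S: "cfun.subspace ?S"
  proof (rule cfun.subspaceI)
    show "0 \<in> ?S" by (simp add: L2_fun_def zero_fun_def)
  next
    fix p q assume "p \<in> ?S" "q \<in> ?S"
    then have *: "p \<in> L2_fun ?B" "q \<in> L2_fun ?B" "(\<integral>x. ?d x * cnj (cnj (p x)) \<partial>?B) = 0" "(\<integral>x. ?d x * cnj (cnj (q x)) \<partial>?B) = 0"
      by auto
    have "(\<integral>x. ?d x * cnj (cnj (p x)) + ?d x * cnj (cnj (q x)) \<partial>?B) = 0"
      using * by (subst Bochner_Integration.integral_add[OF L2_fun_mult_integrable[OF d cL] L2_fun_mult_integrable[OF d cL]]) auto
    then show "p + q \<in> ?S"
      using L2_fun_add[OF *(1,2)] by (simp add: plus_fun_def distrib_left)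
  next
    fix c p assume "p \<in> ?S"
    then show "fscale c p \<in> ?S"
      by (simp add: fscale_def L2_fun_scale mult.left_commute[of _ c])
  qed
  have restr: "restrict0 (cball 0 R) g \<in> ?S" if g: "g \<in> L2_fun ?B" "(\<integral>x. ?d x * cnj (cnj (g x)) \<partial>?B) = 0" for g
  proof -
    have "restrict0 (cball 0 R) (restrict0 (cball 0 R) g) = restrict0 (cball 0 R) g"
      by (simp add: restrict0_def fun_eq_iff)
    then have "restrict0 (cball 0 R) g \<in> L2_fun ?B"
      using g(1) by (simp only: L2_fun_ball_iff)
    moreover have "(\<integral>x. ?d x * cnj (cnj (restrict0 (cball 0 R) g x)) \<partial>?B) = (\<integral>x. ?d x * cnj (cnj (g x)) \<partial>?B)"
      by (intro Bochner_Integration.integral_cong) (auto simp: restrict0_def)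
    ultimately show ?thesis using g(2) by simp
  qed
  have "(\<lambda>k. restrict0 (cball 0 R) (phic \<phi> k)) ` {..<?r} \<subseteq> ?S"
  proof
    fix p assume "p \<in> (\<lambda>k. restrict0 (cball 0 R) (phic \<phi> k)) ` {..<?r}"
    then obtain k where k: "k < ?r" "p = restrict0 (cball 0 R) (phic \<phi> k)" by auto
    show "p \<in> ?S"
      unfolding k(2) using residual_orthogonal[OF \<phi> w k(1)]
      by (intro restr phic_L2_fun[OF \<phi>]) (simp add: phic_def)
  qed
  from cfun.span_minimal[OF this S]
  have "poly_ball R n \<subseteq> ?S"
    using \<phi> unfolding poly_onb_def phic_def[abs_def] by blast
  moreover have "restrict0 (cball 0 R) f \<in> poly_ball R n"
    using f by (simp add: poly_ball_def)
  ultimately have "(\<integral>x. ?d x * restrict0 (cball 0 R) f x \<partial>?B) = 0" by auto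
  also have "(\<integral>x. ?d x * restrict0 (cball 0 R) f x \<partial>?B) = (\<integral>x. f x * restrict0 (cball 0 R) ?d x \<partial>lborel)"
    unfolding integral_ball by (intro Bochner_Integration.integral_cong) (auto simp: restrict0_def)
  finally show ?thesis .
qed

text \<open>\<open>w\<close> differs from its residual by a combination orthogonal to that residual.
  Having \<open>w\<close> itself in the pairing is what later allows any extension to take its
  place.\<close>

lemma residual_self_pairing:
  assumes \<phi>: "poly_onb R \<phi>" and w: "w \<in> L2_fun (ball_measure R)"
  shows "(\<integral>x. w x * cnj (residual (ball_measure R) \<phi> r w x) \<partial>ball_measure R)
    = complex_of_real ((L2_fnorm (ball_measure R) (residual (ball_measure R) \<phi> r w))\<^sup>2)"
proof -
  let ?B = "ball_measure R"
  let ?d = "residual ?B \<phi> r w" and ?S = "\<lambda>x. \<Sum>k<r. coef ?B \<phi> w k * phic \<phi> k x"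
  have d: "?d \<in> L2_fun ?B" by (rule residual_L2_fun[OF \<phi> w])
  have S: "?S \<in> L2_fun ?B" by (rule phic_sum_L2_fun[OF \<phi>])
  have "(\<integral>x. ?S x * cnj (?d x) \<partial>?B) = (\<Sum>k<r. coef ?B \<phi> w k * (\<integral>x. phic \<phi> k x * cnj (?d x) \<partial>?B))"
    unfolding sum_distrib_right mult.assoc
    by (subst Bochner_Integration.integral_sum) (auto intro!: L2_fun_mult_integrable phic_L2_fun \<phi> d)
  also have "\<dots> = 0"
  proof (rule sum.neutral, rule ballI)
    fix k assume "k \<in> {..<r}"
    then have "cnj (\<integral>x. ?d x * cnj (phic \<phi> k x) \<partial>?B) = 0"
      using residual_orthogonal[OF \<phi> w] by simp
    then have "(\<integral>x. phic \<phi> k x * cnj (?d x) \<partial>?B) = 0"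
      unfolding Bochner_Integration.integral_cnj[symmetric] by (simp add: mult.commute)
    then show "coef ?B \<phi> w k * (\<integral>x. phic \<phi> k x * cnj (?d x) \<partial>?B) = 0" by simp
  qed
  finally have S0: "(\<integral>x. ?S x * cnj (?d x) \<partial>?B) = 0" .
  have "(\<integral>x. w x * cnj (?d x) \<partial>?B) = (\<integral>x. ?d x * cnj (?d x) + ?S x * cnj (?d x) \<partial>?B)"
    by (intro Bochner_Integration.integral_cong) (auto simp: residual_def distrib_right[symmetric])
  also have "\<dots> = (\<integral>x. ?d x * cnj (?d x) \<partial>?B)"
    using S0 by (simp add: Bochner_Integration.integral_add[OF L2_fun_mult_integrable[OF d d] L2_fun_mult_integrable[OF S d]])
  also have "\<dots> = complex_of_real ((L2_fnorm ?B ?d)\<^sup>2)"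
    unfolding complex_norm_square[symmetric] L2_fnorm_square integral_complex_of_real ..
  finally show ?thesis .
qed

text \<open>An extension agrees almost everywhere on the ball with the representative, so it may
  replace it in the self-pairing. One factor of the residual norm then cancels.\<close>

lemma residual_Hs_estimate:
  fixes R s :: real
  assumes R: "R > 0" and s: "s > 0"
  obtains K where "K > 0"
    "\<And>(\<phi> :: nat \<Rightarrow> real ^ 'n \<Rightarrow> real) n v. poly_onb R \<phi> \<Longrightarrow> v \<in> Hs_ball R s \<Longrightarrow>
      L2_fnorm (ball_measure R) (residual (ball_measure R) \<phi> (poly_dim TYPE('n) R n) (L2_rep v))
        \<le> K * real (Suc n) powr (- s) * Hs_ball_norm R s v"
proof -
  obtain K where K: "K > 0" and
    KF: "\<And>n (h :: real ^ 'n \<Rightarrow> complex) U. h \<in> L2_fun lborel \<Longrightarrow> (\<And>x. x \<notin> cball 0 R \<Longrightarrow> h x = 0) \<Longrightarrow>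
      (\<And>f. f \<in> poly_funs n \<Longrightarrow> (\<integral>x. f x * h x \<partial>lborel) = 0) \<Longrightarrow> U \<in> Hs_space s \<Longrightarrow>
      cmod (\<integral>x. U x * cnj (h x) \<partial>lborel) \<le> K * real (Suc n) powr (- s) * L2_fnorm lborel h * Hs_space_norm s U"
    by (rule Hs_pairing_estimate[OF R s]) blast
  show ?thesis
  proof (rule that[OF K])
    fix \<phi> :: "nat \<Rightarrow> real ^ 'n \<Rightarrow> real" and n and v :: "(real ^ 'n \<Rightarrow> complex) set"
    assume \<phi>: "poly_onb R \<phi>" and v: "v \<in> Hs_ball R s"
    let ?B = "ball_measure R :: (real ^ 'n) measure" and ?r = "poly_dim TYPE('n) R n"
    have vL: "v \<in> L2 ?B" and ne: "v \<inter> Hs_space s \<noteq> {}" using v by (auto simp: Hs_ball_def)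
    define w where "w = L2_rep v"
    have w: "w \<in> L2_fun ?B" unfolding w_def by (rule L2_rep_fun[OF vL])
    define d where "d = residual ?B \<phi> ?r w"
    have d: "d \<in> L2_fun ?B" unfolding d_def by (rule residual_L2_fun[OF \<phi> w])
    let ?h = "restrict0 (cball 0 R) d"
    have h: "?h \<in> L2_fun lborel" using d by (simp only: L2_fun_ball_iff)
    let ?E = "L2_fnorm ?B d" and ?k = "K * real (Suc n) powr (- s)"
    have k: "?k > 0" using K by simp
    \<comment> \<open>Divided by \<open>?k\<close> so that the left side is a lower bound
      independent of \<open>U\<close>, as the infimum requires.\<close>
    have "?E / ?k \<le> Hs_space_norm s U" if U: "U \<in> v" "U \<in> Hs_space s" for U
    proof -
      note UB = L2_element[OF vL U(1)]
      have "complex_of_real (?E\<^sup>2) = (\<integral>x. w x * cnj (d x) \<partial>?B)"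
        unfolding d_def by (rule residual_self_pairing[OF \<phi> w, symmetric])
      also have "\<dots> = (\<integral>x. U x * cnj (d x) \<partial>?B)"
        using UB(2) borel_measurable_integrable[OF L2_fun_mult_integrable[OF w d]]
          borel_measurable_integrable[OF L2_fun_mult_integrable[OF UB(1) d]]
        by (intro integral_cong_AE) (auto simp: w_def elim: eventually_mono)
      also have "\<dots> = (\<integral>x. U x * cnj (?h x) \<partial>lborel)"
        unfolding integral_ball by (intro Bochner_Integration.integral_cong) (auto simp: restrict0_def)
      finally have "?E\<^sup>2 = cmod (\<integral>x. U x * cnj (?h x) \<partial>lborel)"
        by (metis abs_power2 norm_of_real)
      also have "\<dots> \<le> ?k * L2_fnorm lborel ?h * Hs_space_norm s U"
      proof (rule KF[OF h _ _ U(2)])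
        show "?h x = 0" if "x \<notin> cball 0 R" for x using that by (simp add: restrict0_def)
        show "(\<integral>x. f x * ?h x \<partial>lborel) = 0" if "f \<in> poly_funs n" for f
          unfolding d_def by (rule residual_orthogonal_poly[OF \<phi> w that])
      qed
      also have "L2_fnorm lborel ?h = ?E" by (rule L2_fnorm_ball[symmetric])
      finally have E: "?E * ?E \<le> ?E * (?k * Hs_space_norm s U)" by (simp add: power2_eq_square mult_ac)
      have "?E \<le> ?k * Hs_space_norm s U"
      proof (cases "?E = 0")
        case True
        have "Hs_space_norm s U \<ge> 0" by (simp add: Hs_space_norm_def Let_def)
        with True k show ?thesis by simp
      next
        case False
        then have "?E > 0" using L2_fnorm_nonneg[of ?B d] by simp
        with E show ?thesis by (simp only: mult_le_cancel_left_pos)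
      qed
      with k show ?thesis by (simp add: divide_le_eq mult.commute)
    qed
    then have "?E / ?k \<le> Hs_ball_norm R s v"
      unfolding Hs_ball_norm_def using ne by (intro cInf_greatest) auto
    with k have "?E \<le> ?k * Hs_ball_norm R s v" by (simp add: divide_le_eq mult.commute)
    then show "L2_fnorm ?B (residual ?B \<phi> ?r (L2_rep v)) \<le> K * real (Suc n) powr (- s) * Hs_ball_norm R s v"
      by (simp only: d_def w_def)
  qed
qed

text \<open>The constant 1 restricts to a nonzero function. Positivity matters because
  \<open>0 powr a\<close> is 0 by convention, so the rate would degenerate at p = 0.\<close>

lemma poly_dim_pos:
  assumes \<phi>: "poly_onb R (\<phi> :: nat \<Rightarrow> real ^ 'n \<Rightarrow> real)" and R: "R > 0"
  shows "poly_dim TYPE('n) R n > 0"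
proof (rule ccontr)
  assume "\<not> ?thesis"
  moreover have "cfun.span ((\<lambda>k. restrict0 (cball 0 R) (\<lambda>x. complex_of_real (\<phi> k x))) ` {..<poly_dim TYPE('n) R n}) = poly_ball R n"
    using \<phi> unfolding poly_onb_def by blast
  ultimately have "poly_ball R n = {0 :: real ^ 'n \<Rightarrow> complex}" by simp
  moreover have "restrict0 (cball 0 R) (\<lambda>_::real ^ 'n. 1) \<in> poly_ball R n"
    unfolding poly_ball_def using const_in_poly_funs by blast
  ultimately have "restrict0 (cball 0 R) (\<lambda>_::real ^ 'n. 1) = 0" by simp
  then have "restrict0 (cball 0 R) (\<lambda>_::real ^ 'n. 1) 0 = (0::complex)" by (simp only: zero_fun_def)
  with R show False by (simp add: restrict0_def)
qed

text \<open>The integrability conjunct gives the error its meaning: the Bochner integral of a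
  non-integrable function is 0 by default, which would make the bound hollow.\<close>

theorem theorem4p3:
  fixes R s :: real
  assumes "CARD('n::finite) = 2 \<or> CARD('n) = 3" and "R > 0" and "s > 0"
  shows "\<exists>C>0. \<forall>(\<phi> :: nat \<Rightarrow> real ^ 'n \<Rightarrow> real)
      (\<mu> :: ((real ^ 'n) \<times> (real ^ 'n) \<Rightarrow> complex) set measure)
      (G :: ((real ^ 'n) \<times> (real ^ 'n) \<Rightarrow> complex) set \<Rightarrow> (real ^ 'n \<Rightarrow> complex) set)
      (Cq :: real) (n :: nat)
      (Rec :: (nat \<Rightarrow> real) \<Rightarrow> (real ^ 'n \<Rightarrow> complex) set)
      (Proj :: (real ^ 'n \<Rightarrow> complex) set \<Rightarrow> (nat \<Rightarrow> real)).
      let B = ball_measure R;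
          \<nu> = distr \<mu> (L2_borel B) G;
          r = poly_dim TYPE('n) R n;
          p = 2 * r
      in
        poly_onb R \<phi> \<longrightarrow>
        prob_space \<mu> \<longrightarrow> sets \<mu> = sets (L2_borel sphere_prod_measure) \<longrightarrow>
        G \<in> measurable \<mu> (L2_borel B) \<longrightarrow>
        L2_supp B \<nu> \<subseteq> Hs_ball R s \<longrightarrow>
        (\<forall>q \<in> L2_supp B \<nu>. Hs_ball_norm R s q \<le> Cq) \<longrightarrow>
        Proj \<in> L2 B \<rightarrow> euclid p \<longrightarrow>
        Rec \<in> euclid p \<rightarrow> L2 B \<longrightarrow>
        (\<forall>v \<in> L2 B. (Rec \<circ> Proj) v = onb_proj R \<phi> r v) \<longrightarrow>
        integrable \<nu> (\<lambda>v. (L2_dist B ((Rec \<circ> Proj) v) v)\<^sup>2) \<and>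
        recon_error B \<nu> (Rec \<circ> Proj) \<le> C * Cq * real p powr (- s / real CARD('n)) \<and>
        (\<forall>\<epsilon>>0. real p \<ge> (C * Cq / \<epsilon>) powr (real CARD('n) / s) \<longrightarrow>
           recon_error B \<nu> (Rec \<circ> Proj) \<le> \<epsilon>)"
proof -
  note R = assms(2) and s = assms(3)
  let ?B = "ball_measure R :: (real ^ 'n) measure"
  define d where "d = real CARD('n)"
  have d: "d > 0" by (simp add: d_def)
  obtain K where K: "K > 0" and
    KF: "\<And>(\<phi> :: nat \<Rightarrow> real ^ 'n \<Rightarrow> real) n v. poly_onb R \<phi> \<Longrightarrow> v \<in> Hs_ball R s \<Longrightarrow>
      L2_fnorm ?B (residual ?B \<phi> (poly_dim TYPE('n) R n) (L2_rep v)) \<le> K * real (Suc n) powr (- s) * Hs_ball_norm R s v"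
    by (rule residual_Hs_estimate[OF R s]) blast
  \<comment> \<open>The power of 2 compensates p \<le> 2 (n + 1)^d; \<open>K\<close> was obtained
    before the basis, the measure and the degree are introduced.\<close>
  define C where "C = K * 2 powr (s / d)"
  have C: "C > 0" using K by (simp add: C_def)
  \<comment> \<open>Only the law on L^2 of the ball and the values of the composite on
    \<open>L2 ?B\<close> matter, so \<mu>, \<open>G\<close>, \<open>Rec\<close> and
    \<open>Proj\<close> are replaced by \<nu> and \<open>F\<close>.\<close>
  have main: "integrable \<nu> (\<lambda>v. (L2_dist ?B (F v) v)\<^sup>2) \<and>
      recon_error ?B \<nu> F \<le> C * Cq * real p powr (- s / d) \<and>
      (\<forall>\<epsilon>>0. real p \<ge> (C * Cq / \<epsilon>) powr (d / s) \<longrightarrow> recon_error ?B \<nu> F \<le> \<epsilon>)"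
    if \<phi>: "poly_onb R \<phi>" and \<nu>: "prob_space \<nu>" "sets \<nu> = sets (L2_borel ?B)"
      and supp: "L2_supp ?B \<nu> \<subseteq> Hs_ball R s" "\<And>q. q \<in> L2_supp ?B \<nu> \<Longrightarrow> Hs_ball_norm R s q \<le> Cq"
      and F: "\<And>v. v \<in> L2 ?B \<Longrightarrow> F v = onb_proj R \<phi> (poly_dim TYPE('n) R n) v"
      and p: "p = 2 * poly_dim TYPE('n) R n"
    for \<phi> :: "nat \<Rightarrow> real ^ 'n \<Rightarrow> real" and \<nu> Cq n F p
  proof -
    interpret prob_space \<nu> by (rule \<nu>(1))
    let ?r = "poly_dim TYPE('n) R n"
    let ?N = "\<lambda>v. L2_dist ?B (F v) v"
    have N: "?N v = L2_fnorm ?B (residual ?B \<phi> ?r (L2_rep v))" if "v \<in> L2 ?B" for v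
      using F[OF that] L2_dist_onb_proj[OF \<phi> that] by simp
    have "?N \<in> borel_measurable (L2_borel ?B)"
    proof (rule borel_measurable_L2_Lipschitz)
      fix u v assume u: "u \<in> L2 ?B" and v: "v \<in> L2 ?B"
      show "?N u \<le> ?N v + (1 + real ?r) * L2_dist ?B v u"
        unfolding N[OF u] N[OF v] unfolding L2_dist_def
        by (rule residual_Lipschitz[OF \<phi> L2_rep_fun[OF u] L2_rep_fun[OF v]])
    qed
    then have meas [measurable]: "?N \<in> borel_measurable \<nu>"
      using measurable_cong_sets[OF \<nu>(2) refl] by blast
    have N0: "?N v \<ge> 0" for v by (simp add: L2_dist_def L2_fnorm_nonneg)
    obtain D where D: "countable D" "D \<subseteq> L2 ?B" "\<And>v e. v \<in> L2 ?B \<Longrightarrow> e > 0 \<Longrightarrow> \<exists>u\<in>D. L2_dist ?B v u < e"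
      by (rule L2_ball_separable[OF \<phi>]) blast
    have AE_supp: "AE v in \<nu>. v \<in> L2_supp ?B \<nu>" by (rule AE_in_L2_supp[OF D \<nu>(2)])
    let ?b = "K * real (Suc n) powr (- s) * Cq"
    have bound: "?N v \<le> ?b" if v: "v \<in> L2_supp ?B \<nu>" for v
    proof -
      have "v \<in> L2 ?B" using v by (simp add: L2_supp_def)
      then have "?N v \<le> K * real (Suc n) powr (- s) * Hs_ball_norm R s v"
        using N KF[OF \<phi>] supp(1) v by auto
      also have "\<dots> \<le> ?b" using K supp(2)[OF v] by (intro mult_left_mono) auto
      finally show ?thesis .
    qed
    \<comment> \<open>\<open>Cq\<close> is not assumed nonnegative. A probability measure has a
      point in its support, where the bound dominates a norm, so the sign of \<open>Cq\<close>
      follows.\<close>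
    have "L2_supp ?B \<nu> \<noteq> {}"
      using AE_supp AE_False prob_space_axioms not_empty by (auto simp: emeasure_space_1)
    then obtain v0 where "v0 \<in> L2_supp ?B \<nu>" by blast
    then have b0: "?b \<ge> 0" using bound N0 order_trans by blast
    moreover have "K * real (Suc n) powr (- s) > 0" using K by simp
    ultimately have Cq: "Cq \<ge> 0"
      using zero_le_mult_iff[of "K * real (Suc n) powr (- s)" Cq] by linarith
    have AE_b: "AE v in \<nu>. (?N v)\<^sup>2 \<le> ?b\<^sup>2"
      using AE_supp by eventually_elim (intro power_mono bound N0)
    have int: "integrable \<nu> (\<lambda>v. (?N v)\<^sup>2)"
      by (rule integrable_const_bound[of _ "?b\<^sup>2"]) (use AE_b in auto)
    have "(\<integral>v. (?N v)\<^sup>2 \<partial>\<nu>) \<le> (\<integral>v. ?b\<^sup>2 \<partial>\<nu>)"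
      by (rule integral_mono_AE[OF int _ AE_b]) simp
    then have "recon_error ?B \<nu> F \<le> sqrt (?b\<^sup>2)"
      unfolding recon_error_def by (intro real_sqrt_le_mono) (simp add: prob_space)
    then have err: "recon_error ?B \<nu> F \<le> ?b" using b0 by simp
    have p0: "real p > 0" using poly_dim_pos[OF \<phi> R, of n] p by simp
    have "real ?r \<le> real (Suc n) ^ CARD('n)"
      using poly_dim_le[where 'n='n, of R n] by (simp only: of_nat_power[symmetric] of_nat_le_iff)
    then have "real p \<le> 2 * real (Suc n) powr d"
      by (simp add: p d_def powr_realpow)
    \<comment> \<open>The exponent is negative, so an upper bound for p becomes a lower bound for
      its power; this needs p positive.\<close>
    then have "(2 * real (Suc n) powr d) powr (- s / d) \<le> real p powr (- s / d)"
      using p0 s d by (intro powr_mono2') auto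
    also have "(2 * real (Suc n) powr d) powr (- s / d) = 2 powr (- s / d) * real (Suc n) powr (- s)"
      using d by (simp add: powr_mult powr_powr)
    finally have "2 powr (s / d) * (2 powr (- s / d) * real (Suc n) powr (- s)) \<le> 2 powr (s / d) * real p powr (- s / d)"
      by (intro mult_left_mono) auto
    moreover have "2 powr (s / d) * 2 powr (- s / d) = (1 :: real)" by (simp flip: powr_add)
    ultimately have "real (Suc n) powr (- s) \<le> 2 powr (s / d) * real p powr (- s / d)"
      by (simp only: mult.assoc[symmetric] mult_1_left)
    then have "K * Cq * real (Suc n) powr (- s) \<le> K * Cq * (2 powr (s / d) * real p powr (- s / d))"
      using K Cq by (intro mult_left_mono) auto
    with err have err2: "recon_error ?B \<nu> F \<le> C * Cq * real p powr (- s / d)"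
      by (simp add: C_def mult_ac)
    moreover have "recon_error ?B \<nu> F \<le> \<epsilon>" if \<epsilon>: "\<epsilon> > 0" and le: "real p \<ge> (C * Cq / \<epsilon>) powr (d / s)" for \<epsilon>
    proof -
      \<comment> \<open>The exponents d/s and s/d undo each other because the base is nonnegative;
        the case \<open>Cq = 0\<close> is included.\<close>
      have "C * Cq / \<epsilon> = ((C * Cq / \<epsilon>) powr (d / s)) powr (s / d)"
        using s d C Cq \<epsilon> by (simp add: powr_powr)
      also have "\<dots> \<le> real p powr (s / d)"
        using s d by (intro powr_mono2 le) auto
      finally have "C * Cq \<le> \<epsilon> * real p powr (s / d)" using \<epsilon> by (simp add: field_simps)
      then have "C * Cq * real p powr (- s / d) \<le> \<epsilon> * real p powr (s / d) * real p powr (- s / d)"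
        by (intro mult_right_mono) auto
      also have "\<dots> = \<epsilon>" using p0 by (simp add: mult.assoc flip: powr_add)
      finally show ?thesis using err2 by linarith
    qed
    ultimately show ?thesis using int by blast
  qed
  show ?thesis
    unfolding Let_def
  proof (intro exI[of _ C] conjI[OF C] allI impI, goal_cases)
    case (1 \<phi> \<mu> G Cq n Rec Proj)
    then show ?case
      using main[of \<phi> "distr \<mu> (L2_borel ?B) G" Cq "Rec \<circ> Proj" n "2 * poly_dim TYPE('n) R n"] prob_space.prob_space_distr[of \<mu> G "L2_borel ?B"]
      unfolding d_def by auto
  qed
qed

end
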